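(* Let $d>1$ be a square-free integer and let $\mathcal{O}$ be the ring of integers of $\mathbb{Q}(\sqrt{d})$. Then the set $\{\pi_1/\pi_2 : \pi_1,\pi_2 \text{ are prime elements of } \mathcal{O}\}$ is dense in $\mathbb{R}$.
   Context: The ring of integers of $\mathbb{Q}(\sqrt d)$ is $\mathcal{O}=\mathbb{Z}[\sqrt d]$ if $d\not\equiv 1\pmod 4$ and $\mathcal{O}=\mathbb{Z}[\tfrac{1+\sqrt d}{2}]$ if $d\equiv 1\pmod 4$; for $d>0$ it is a subring of $\mathbb{R}$ (with $\sqrt d$ the positive square root). A prime element of $\mathcal{O}$ is a nonzero nonunit $\pi\in\mathcal{O}$ such that whenever $\pi\mid\alpha\beta$ with $\alpha,\beta\in\mathcal{O}$, then $\pi\mid\alpha$ or $\pi\mid\beta$. *)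

theory Defs
  imports
    "HOL-Analysis.Elementary_Topology"
    "HOL-Algebra.Ring_Divisibility"
    "HOL-Computational_Algebra.Squarefree"
begin

definition quad_gen :: "int \<Rightarrow> real"
  where "quad_gen d =
    (if d mod 4 = 1 then (1 + sqrt (of_int d)) / 2 else sqrt (of_int d))"

(* The generator w = quad_gen d is a root of a monic quadratic over the integers (for d >= 0),
   so Z[w] consists of the elements a + b w with integers a, b. *)
definition quad_integers :: "int \<Rightarrow> real set"
  where "quad_integers d = {of_int a + of_int b * quad_gen d | a b. True}"

definition quad_ring :: "int \<Rightarrow> real ring"
  where "quad_ring d =
    \<lparr>carrier = quad_integers d, mult = (*), one = 1, zero = 0, add = (+)\<rparr>"

(* ring_prime does not itself require its argument to lie in the carrier. *)
definition quad_primes :: "int \<Rightarrow> real set"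
  where "quad_primes d = {p \<in> carrier (quad_ring d). ring_prime\<^bsub>quad_ring d\<^esub> p}"

lemma quad_gen_square:
  assumes "d \<ge> 0"
  shows "\<exists>m n :: int. quad_gen d * quad_gen d = of_int m + of_int n * quad_gen d"
proof (cases "d mod 4 = 1")
  case True
  then obtain k where k: "d = 4 * k + 1"
    by (metis mult_div_mod_eq)
  have "sqrt (of_int d) * sqrt (of_int d) = (of_int d :: real)"
    using assms by simp
  then have "quad_gen d * quad_gen d = of_int k + of_int 1 * quad_gen d"
    using True by (simp add: quad_gen_def k field_simps)
  then show ?thesis by blast
next
  case False
  then have "quad_gen d * quad_gen d = of_int d + of_int 0 * quad_gen d"
    using assms by (simp add: quad_gen_def)
  then show ?thesis by blast
qed

lemma quad_integersI: "of_int a + of_int b * quad_gen d \<in> quad_integers d"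
  unfolding quad_integers_def by blast

lemma quad_integers_add:
  assumes "x \<in> quad_integers d" "y \<in> quad_integers d"
  shows "x + y \<in> quad_integers d"
proof -
  obtain a b a' b' where "x = of_int a + of_int b * quad_gen d"
    "y = of_int a' + of_int b' * quad_gen d"
    using assms unfolding quad_integers_def by blast
  then have "x + y = of_int (a + a') + of_int (b + b') * quad_gen d"
    by (simp add: algebra_simps)
  then show ?thesis by (metis quad_integersI)
qed

lemma quad_integers_uminus:
  assumes "x \<in> quad_integers d"
  shows "- x \<in> quad_integers d"
proof -
  obtain a b where "x = of_int a + of_int b * quad_gen d"
    using assms unfolding quad_integers_def by blast
  then have "- x = of_int (- a) + of_int (- b) * quad_gen d"
    by simp
  then show ?thesis by (metis quad_integersI)
qed

lemma quad_integers_mult: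
  assumes "d \<ge> 0" "x \<in> quad_integers d" "y \<in> quad_integers d"
  shows "x * y \<in> quad_integers d"
proof -
  obtain a b a' b' where xy: "x = of_int a + of_int b * quad_gen d"
    "y = of_int a' + of_int b' * quad_gen d"
    using assms unfolding quad_integers_def by blast
  obtain m n :: int where mn: "quad_gen d * quad_gen d = of_int m + of_int n * quad_gen d"
    using quad_gen_square[OF assms(1)] by blast
  have "x * y = of_int (a * a') + of_int (a * b' + b * a') * quad_gen d
      + of_int (b * b') * (quad_gen d * quad_gen d)"
    unfolding xy by (simp add: algebra_simps)
  also have "\<dots> = of_int (a * a' + b * b' * m)
      + of_int (a * b' + b * a' + b * b' * n) * quad_gen d"
    unfolding mn by (simp add: algebra_simps)
  finally show ?thesis by (metis quad_integersI)
qed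

lemma quad_integers_of_int: "of_int a \<in> quad_integers d"
  using quad_integersI[of a 0 d] by simp

lemma quad_ring_domain:
  assumes "d \<ge> 0"
  shows "domain (quad_ring d)"
proof -
  have zero: "0 \<in> quad_integers d" and one: "1 \<in> quad_integers d"
    using quad_integers_of_int[of 0 d] quad_integers_of_int[of 1 d] by simp_all
  have "abelian_group (quad_ring d)"
    by (rule abelian_groupI)
      (auto simp: quad_ring_def zero quad_integers_add intro: bexI[of _ "- _"] quad_integers_uminus)
  moreover have "comm_monoid (quad_ring d)"
    by (rule comm_monoidI) (auto simp: quad_ring_def one quad_integers_mult[OF assms])
  ultimately have "cring (quad_ring d)"
    by (rule cringI) (simp add: quad_ring_def distrib_right)
  then show ?thesis
    by (rule domain.intro) (auto simp: domain_axioms_def quad_ring_def)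
qed

end

theory Submission
  imports Defs "HOL-Complex_Analysis.Complex_Analysis" "HOL-Number_Theory.Number_Theory"
begin

text \<open>A rational prime that is inert in the quadratic field is a prime element of its ring of
  integers, and so are its products with powers of a unit \<open>e > 1\<close>. It therefore suffices that the
  logarithms of the inert primes are dense modulo \<open>ln e\<close>. By quadratic reciprocity the inert primes
  are those with \<open>chi p = -1\<close> for a periodic real character \<open>chi\<close>. The zeta function and the
  \<open>L\<close>-series of \<open>chi\<close> continue to \<open>Re s > 0\<close>, and the inequality
  \<open>3 + 4 cos x + cos 2x \<ge> 0\<close>, applied to their product, excludes zeros at \<open>1 + \<i> \<tau>\<close>, \<open>\<tau> \<noteq> 0\<close>. Hence
  the series \<open>\<Sum> ln p p\<^sup>-\<^sup>s\<close> over inert primes has a pole at \<open>s = 1\<close> and none at \<open>1 + \<i> \<tau>\<close>,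
  so the phases \<open>\<tau> ln p\<close> equidistribute. Whether \<open>L(1, chi)\<close> vanishes is irrelevant, since a zero
  there would only enlarge the pole.\<close>

section \<open>Continuation of Dirichlet series\<close>

text \<open>At each frequency \<tau> a single number is read off at the edge: the limit of
  \<open>h * D(1 + h + i \<tau>)\<close> as h falls to 0. Finitely many such limits decide the
  matter, since a Fejer kernel of fixed length involves finitely many frequencies and its
  nonnegativity survives the limit. The logarithmic derivatives rest on the identity that
  \<open>mangoldt\<close> summed over the divisors of n gives \<open>ln n\<close>. It yields them as
  products, valid also at zeros; near the edge the continued functions are nonzero because their
  zeros are isolated. The orders of these zeros are carried along as unknown natural numbers, and
  their sign always helps: they only lower the coefficients of the series for zeta times L, and a
  zero of L at 1 only raises the coefficient of the inert series at frequency 0. For the density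
  itself the denominator is one fixed inert prime q and the numerator is p times a power of the unit
  e, so that \<open>ln p - k ln e\<close> has to approximate \<open>ln (|x| q)\<close>; the unit -1
  supplies the sign.\<close>

lemma norm_of_nat_powr: "norm ((of_nat n :: complex) powr s) = real n powr Re s"
  by (simp add: norm_powr_real_powr)

text \<open>The exponent is below -1 uniformly near each point, so the Weierstrass test applies
  locally. The factor quadratic in \<open>norm s\<close> leaves room for both series to which this
  is applied: the terms for zeta carry \<open>norm (s - 1) * norm s\<close>.\<close>

lemma holomorphic_on_half_plane_series:
  fixes f :: "nat \<Rightarrow> complex \<Rightarrow> complex"
  assumes hol: "\<And>n. f n holomorphic_on {s. Re s > 0}"
    and bound: "\<And>n s. Re s > 0 \<Longrightarrow>
      norm (f n s) \<le> B * (1 + norm s)\<^sup>2 * real (Suc n) powr (- Re s - 1)"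
    and B: "B \<ge> 0"
  shows "\<exists>g. g holomorphic_on {s. Re s > 0} \<and> (\<forall>s. Re s > 0 \<longrightarrow> (\<lambda>n. f n s) sums g s)"
proof -
  let ?H = "{s. Re s > 0}"
  have op: "open ?H"
    by (simp add: open_halfspace_Re_gt)
  have "\<exists>g g'. \<forall>x\<in>?H. (\<lambda>n. f n x) sums g x \<and> (\<lambda>n. deriv (f n) x) sums g' x
      \<and> (g has_field_derivative g' x) (at x)"
  proof (rule series_and_derivative_comparison_local[OF op])
    show "(f n has_field_derivative deriv (f n) x) (at x)" if "x \<in> ?H" for n x
      using holomorphic_derivI[OF hol op that] .
  next
    fix x :: complex assume "x \<in> ?H"
    then have x: "Re x > 0" by simp
    define r where "r = Re x / 2"
    have r: "r > 0" using x by (simp add: r_def)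
    define h where "h = (\<lambda>n. B * (1 + (norm x + r))\<^sup>2 * real (Suc n) powr (- r - 1))"
    have "summable (\<lambda>n. real n powr (- r - 1))"
      using r by (subst summable_real_powr_iff) simp
    then have "summable (\<lambda>n. real (Suc n) powr (- r - 1))"
      by (subst summable_Suc_iff)
    then have "summable h"
      unfolding h_def by (rule summable_mult)
    moreover have "norm (f n y) \<le> h n" if y: "y \<in> ball x r \<inter> ?H" for n y
    proof -
      have "\<bar>Re x - Re y\<bar> \<le> norm (x - y)"
        using abs_Re_le_cmod[of "x - y"] by simp
      moreover have xy: "norm (x - y) < r"
        using y by (simp add: dist_norm)
      ultimately have "Re y \<ge> r" unfolding r_def by (simp add: abs_le_iff)
      then have 1: "real (Suc n) powr (- Re y - 1) \<le> real (Suc n) powr (- r - 1)"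
        by (intro powr_mono) auto
      have "norm y \<le> norm x + r"
        using norm_triangle_sub[of y x] xy by (simp add: norm_minus_commute)
      then have 2: "B * (1 + norm y)\<^sup>2 \<le> B * (1 + (norm x + r))\<^sup>2"
        by (intro mult_left_mono power_mono B) auto
      have "norm (f n y) \<le> B * (1 + norm y)\<^sup>2 * real (Suc n) powr (- Re y - 1)"
        using y by (intro bound) auto
      also have "\<dots> \<le> h n"
        unfolding h_def by (intro mult_mono 1 2) (use B in auto)
      finally show ?thesis .
    qed
    ultimately show "\<exists>d h. 0 < d \<and> summable h \<and>
        (\<forall>\<^sub>F n in sequentially. \<forall>y\<in>ball x d \<inter> ?H. norm (f n y) \<le> h n)"
      using r by (intro exI[of _ r] exI[of _ h]) auto
  qed
  then obtain g g' where g: "\<And>x. x \<in> ?H \<Longrightarrow> (\<lambda>n. f n x) sums g x"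
      "\<And>x. x \<in> ?H \<Longrightarrow> (g has_field_derivative g' x) (at x)"
    by blast
  have "g holomorphic_on ?H"
    using g(2) op by (metis holomorphic_on_open)
  then show ?thesis using g(1) by blast
qed

lemma norm_diff_le_of_real_derivative_bound:
  fixes \<phi> :: "complex \<Rightarrow> complex"
  assumes "a \<le> b"
    and "\<And>x. a \<le> x \<Longrightarrow> x \<le> b \<Longrightarrow> (\<phi> has_field_derivative \<phi>' x) (at (of_real x))"
    and "\<And>x. a \<le> x \<Longrightarrow> x \<le> b \<Longrightarrow> norm (\<phi>' x) \<le> C"
  shows "norm (\<phi> (of_real b) - \<phi> (of_real a)) \<le> C * (b - a)"
proof -
  have seg: "z = of_real (Re z) \<and> a \<le> Re z \<and> Re z \<le> b"
    if "z \<in> closed_segment (of_real a) (of_real b)" for z :: complex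
    using that assms(1)
    by (auto simp: closed_segment_of_real closed_segment_eq_real_ivl complex_eq_iff)
  have "norm (\<phi> (of_real b) - \<phi> (of_real a)) \<le> C * norm (of_real b - of_real a :: complex)"
  proof (rule field_differentiable_bound[where S = "closed_segment (of_real a) (of_real b)"
        and f' = "\<lambda>z. \<phi>' (Re z)"])
    fix z :: complex assume z: "z \<in> closed_segment (of_real a) (of_real b)"
    show "(\<phi> has_field_derivative \<phi>' (Re z)) (at z within closed_segment (of_real a) (of_real b))"
      using assms(2)[of "Re z"] seg[OF z] by (auto intro: has_field_derivative_at_within)
    show "norm (\<phi>' (Re z)) \<le> C"
      using assms(3) seg[OF z] by blast
  qed auto
  also have "norm (of_real b - of_real a :: complex) = b - a"
    using assms(1) by (metis abs_of_nonneg diff_ge_0_iff_ge norm_of_real of_real_diff)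
  finally show ?thesis .
qed

text \<open>The derivative of \<open>z powr (- s)\<close> at real x has norm
  \<open>norm s * x powr (- Re s - 1)\<close>, which decreases in x, so its value at
  \<open>a\<close> bounds the whole segment.\<close>

lemma norm_powr_diff_le:
  fixes s :: complex and a b :: real
  assumes a: "a > 0" and ab: "a \<le> b" and s: "Re s > 0"
  shows "norm ((of_real b :: complex) powr (- s) - of_real a powr (- s))
    \<le> norm s * a powr (- Re s - 1) * (b - a)"
proof (rule norm_diff_le_of_real_derivative_bound[OF ab,
      where \<phi>' = "\<lambda>x. - s * of_real x powr (- s - 1)"])
  fix x assume x: "a \<le> x" "x \<le> b"
  show "((\<lambda>z. z powr (- s)) has_field_derivative - s * of_real x powr (- s - 1)) (at (of_real x))"
    using x a by (intro has_field_derivative_powr) auto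
  have "x powr (- Re s - 1) \<le> a powr (- Re s - 1)"
    using x a s by (intro powr_mono2') auto
  then show "norm (- s * of_real x powr (- s - 1)) \<le> norm s * a powr (- Re s - 1)"
    using x a by (auto simp: norm_mult norm_powr_real_powr intro!: mult_left_mono)
qed

text \<open>The index 0 contributes nothing because \<open>0 powr z = 0\<close>.\<close>

definition dirichlet_series :: "(nat \<Rightarrow> complex) \<Rightarrow> complex \<Rightarrow> complex"
  where "dirichlet_series a s = (\<Sum>n. a n * of_nat n powr (- s))"

lemma partial_sums_dirichlet_series:
  assumes "summable (\<lambda>n. a n * of_nat n powr (- s))"
  shows "(\<lambda>N. \<Sum>k=1..N. a k * of_nat k powr (- s)) \<longlonglongrightarrow> dirichlet_series a s"
proof -
  have "(\<lambda>N. \<Sum>k<Suc N. a k * of_nat k powr (- s)) \<longlonglongrightarrow> dirichlet_series a s"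
    using summable_LIMSEQ[OF assms] unfolding dirichlet_series_def by (rule LIMSEQ_Suc)
  moreover have "(\<Sum>k<Suc N. a k * of_nat k powr (- s)) = (\<Sum>k=1..N. a k * of_nat k powr (- s))" for N
    by (rule sum.mono_neutral_cong_right) auto
  ultimately show ?thesis by simp
qed

lemma tendsto_nat_powr_zero:
  assumes "Re s > 0"
  shows "(\<lambda>N. (of_nat (N + k) :: complex) powr (- s)) \<longlonglongrightarrow> 0"
proof (rule tendsto_norm_zero_cancel)
  have "(\<lambda>N. real N powr (- Re s)) \<longlonglongrightarrow> 0"
    using assms by (intro tendsto_neg_powr filterlim_real_sequentially) auto
  then have "(\<lambda>N. real (N + k) powr (- Re s)) \<longlonglongrightarrow> 0"
    by (rule LIMSEQ_ignore_initial_segment)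
  then show "(\<lambda>N. norm ((of_nat (N + k) :: complex) powr (- s))) \<longlonglongrightarrow> 0"
    unfolding norm_of_nat_powr by simp
qed

text \<open>Abel summation: bounded partial sums multiply differences of consecutive powers, which
  are one order smaller than the powers themselves. The rearranged series therefore converges on the
  whole right half plane, and it agrees with the original one wherever the latter converges.\<close>

lemma dirichlet_series_continuation:
  fixes a :: "nat \<Rightarrow> complex"
  assumes bound: "\<And>N. norm (\<Sum>k=1..N. a k) \<le> B"
  obtains g where "g holomorphic_on {s. Re s > 0}"
    and "\<And>s. Re s > 0 \<Longrightarrow> summable (\<lambda>n. a n * of_nat n powr (- s)) \<Longrightarrow> g s = dirichlet_series a s"
proof -
  define X where "X = (\<lambda>N. \<Sum>k=1..N. a k)"
  define f where "f = (\<lambda>n s. X (Suc n) * (of_nat (Suc n) powr (- s) - of_nat (Suc (Suc n)) powr (- s)))"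
  have B: "B \<ge> 0" using bound[of 0] by simp
  have "\<exists>g. g holomorphic_on {s. Re s > 0} \<and> (\<forall>s. Re s > 0 \<longrightarrow> (\<lambda>n. f n s) sums g s)"
  proof (rule holomorphic_on_half_plane_series[OF _ _ B])
    show "f n holomorphic_on {s. Re s > 0}" for n
      unfolding f_def by (intro holomorphic_intros) (auto simp del: of_nat_Suc)
  next
    fix n :: nat and s :: complex assume s: "Re s > 0"
    have *: "norm ((of_nat (Suc n) :: complex) powr (- s) - of_nat (Suc (Suc n)) powr (- s))
        \<le> norm s * real (Suc n) powr (- Re s - 1)"
      using norm_powr_diff_le[of "real (Suc n)" "real (Suc (Suc n))" s] s
      by (simp add: norm_minus_commute)
    have "norm s \<le> (1 + norm s)\<^sup>2"
      by (simp add: power2_eq_square algebra_simps)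
    then have "norm s * real (Suc n) powr (- Re s - 1) \<le> (1 + norm s)\<^sup>2 * real (Suc n) powr (- Re s - 1)"
      by (intro mult_right_mono) auto
    then have "norm (X (Suc n)) * norm ((of_nat (Suc n) :: complex) powr (- s) - of_nat (Suc (Suc n)) powr (- s))
        \<le> B * ((1 + norm s)\<^sup>2 * real (Suc n) powr (- Re s - 1))"
      unfolding X_def by (intro mult_mono bound order_trans[OF *]) (use B in auto)
    then show "norm (f n s) \<le> B * (1 + norm s)\<^sup>2 * real (Suc n) powr (- Re s - 1)"
      unfolding f_def by (simp add: norm_mult mult.assoc)
  qed
  then obtain g where g: "g holomorphic_on {s. Re s > 0}" "\<And>s. Re s > 0 \<Longrightarrow> (\<lambda>n. f n s) sums g s"
    by blast
  \<comment> \<open>Summation by parts; the boundary term tends to 0 because \<open>X\<close> is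
    bounded.\<close>
  have part: "(\<Sum>n<N. f n s) = (\<Sum>k=1..N. a k * of_nat k powr (- s)) - X N * of_nat (N + 1) powr (- s)"
    for N s
    by (induction N) (simp_all add: f_def X_def algebra_simps)
  have "g s = dirichlet_series a s"
    if s: "Re s > 0" and summ: "summable (\<lambda>n. a n * of_nat n powr (- s))" for s
  proof -
    have "(\<lambda>N. X N * of_nat (N + 1) powr (- s)) \<longlonglongrightarrow> 0"
    proof (rule tendsto_norm_zero_cancel, rule Lim_null_comparison)
      show "\<forall>\<^sub>F N in sequentially. norm (norm (X N * of_nat (N + 1) powr (- s)))
          \<le> B * norm ((of_nat (N + 1) :: complex) powr (- s))"
        using bound by (auto simp: norm_mult X_def intro!: mult_right_mono always_eventually)
      show "(\<lambda>N. B * norm ((of_nat (N + 1) :: complex) powr (- s))) \<longlonglongrightarrow> 0"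
        using tendsto_mult_right_zero[OF tendsto_norm_zero[OF tendsto_nat_powr_zero[OF s, of 1]], of B] by simp
    qed
    from tendsto_diff[OF partial_sums_dirichlet_series[OF summ] this]
    have "(\<lambda>N. \<Sum>n<N. f n s) \<longlonglongrightarrow> dirichlet_series a s"
      unfolding part by simp
    then show ?thesis
      using g(2)[OF s] unfolding sums_def by (metis LIMSEQ_unique)
  qed
  with g(1) show ?thesis by (rule that)
qed

text \<open>The function continued is \<open>(s - 1) * zeta s\<close>, so that the pole is already
  cancelled. Each term compares \<open>(s - 1) * n powr (- s)\<close> with \<open>s - 1\<close>
  times the integral of \<open>x powr (- s)\<close> over \<open>[n, n + 1]\<close>. The integrals
  telescope, and the leftover -1 is compensated by adding 1 to the sum; at s = 1 all terms
  vanish.\<close>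

lemma zeta_continuation:
  obtains g where "g holomorphic_on {s. Re s > 0}" and "g 1 = 1"
    and "\<And>s. Re s > 1 \<Longrightarrow> summable (\<lambda>n. of_nat n powr (- s) :: complex) \<Longrightarrow>
      g s = (s - 1) * dirichlet_series (\<lambda>_. 1) s"
proof -
  define f :: "nat \<Rightarrow> complex \<Rightarrow> complex"
    where "f = (\<lambda>n s. (s - 1) * of_nat (Suc n) powr (- s)
      + of_nat (Suc (Suc n)) powr (1 - s) - of_nat (Suc n) powr (1 - s))"
  have "\<exists>g. g holomorphic_on {s. Re s > 0} \<and> (\<forall>s. Re s > 0 \<longrightarrow> (\<lambda>n. f n s) sums g s)"
  proof (rule holomorphic_on_half_plane_series[where B = 1])
    show "f n holomorphic_on {s. Re s > 0}" for n
      unfolding f_def by (intro holomorphic_intros) (auto simp del: of_nat_Suc)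
  next
    fix n :: nat and s :: complex assume s: "Re s > 0"
    define c where "c = real (Suc n)"
    have c: "c > 0" by (simp add: c_def)
    \<comment> \<open>The increment of this function from c to c + 1 is the n-th term, and its
      derivative vanishes at c. This gains the extra power of c over a first-order bound.\<close>
    define \<phi> where "\<phi> = (\<lambda>z. (s - 1) * of_real c powr (- s) * z + z powr (1 - s))"
    have "norm (\<phi> (of_real (c + 1)) - \<phi> (of_real c))
        \<le> (norm (s - 1) * (norm s * c powr (- Re s - 1))) * ((c + 1) - c)"
    proof (rule norm_diff_le_of_real_derivative_bound[
          where \<phi>' = "\<lambda>x. (s - 1) * of_real c powr (- s) + (1 - s) * of_real x powr (1 - s - 1)"])
      fix x assume x: "c \<le> x" "x \<le> c + 1"
      show "(\<phi> has_field_derivative (s - 1) * of_real c powr (- s) + (1 - s) * of_real x powr (1 - s - 1))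
          (at (of_real x))"
        unfolding \<phi>_def using x c
        by (auto intro!: derivative_eq_intros)
      have "norm ((of_real x :: complex) powr (- s) - of_real c powr (- s))
          \<le> norm s * c powr (- Re s - 1) * (x - c)"
        using norm_powr_diff_le[OF c x(1) s] .
      also have "\<dots> \<le> norm s * c powr (- Re s - 1) * 1"
        using x by (intro mult_left_mono) auto
      finally have *: "norm ((of_real x :: complex) powr (- s) - of_real c powr (- s))
          \<le> norm s * c powr (- Re s - 1)" by simp
      have "(s - 1) * of_real c powr (- s) + (1 - s) * of_real x powr (1 - s - 1)
          = - ((s - 1) * (of_real x powr (- s) - of_real c powr (- s)))"
        by (simp add: algebra_simps)
      then show "norm ((s - 1) * of_real c powr (- s) + (1 - s) * of_real x powr (1 - s - 1))
          \<le> norm (s - 1) * (norm s * c powr (- Re s - 1))"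
        using * by (simp only: norm_minus_cancel norm_mult mult_left_mono norm_ge_zero)
    qed auto
    also have "\<phi> (of_real (c + 1)) - \<phi> (of_real c) = f n s"
      unfolding f_def \<phi>_def c_def by (simp add: algebra_simps)
    finally have "norm (f n s) \<le> norm (s - 1) * norm s * c powr (- Re s - 1)"
      by simp
    also have "\<dots> \<le> (1 + norm s)\<^sup>2 * c powr (- Re s - 1)"
    proof (intro mult_right_mono)
      have "norm (s - 1) \<le> 1 + norm s"
        using norm_triangle_ineq4[of s 1] by simp
      then show "norm (s - 1) * norm s \<le> (1 + norm s)\<^sup>2"
        unfolding power2_eq_square by (intro mult_mono) auto
    qed auto
    finally show "norm (f n s) \<le> 1 * (1 + norm s)\<^sup>2 * real (Suc n) powr (- Re s - 1)"
      by (simp add: c_def)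
  qed auto
  then obtain g where g: "g holomorphic_on {s. Re s > 0}" "\<And>s. Re s > 0 \<Longrightarrow> (\<lambda>n. f n s) sums g s"
    by blast
  have part: "(\<Sum>n<N. f n s) = (s - 1) * (\<Sum>k=1..N. 1 * of_nat k powr (- s))
      + of_nat (N + 1) powr (- (s - 1)) - 1" for N s
    by (induction N) (simp_all add: f_def algebra_simps)
  show ?thesis
  proof (rule that[of "\<lambda>s. 1 + g s"])
    show "(\<lambda>s. 1 + g s) holomorphic_on {s. Re s > 0}"
      by (intro holomorphic_intros g)
    have "f n 1 = 0" for n by (simp add: f_def del: of_nat_Suc)
    then have "g 1 = 0"
      using g(2)[of 1] by (simp add: sums_iff)
    then show "1 + g 1 = 1" by simp
    fix s :: complex assume s: "Re s > 1" and "summable (\<lambda>n. of_nat n powr (- s) :: complex)"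
    then have "summable (\<lambda>n. 1 * of_nat n powr (- s) :: complex)" by simp
    from tendsto_diff[OF tendsto_add[OF tendsto_mult[OF tendsto_const[of "s - 1"]
            partial_sums_dirichlet_series[OF this]] tendsto_nat_powr_zero[of "s - 1" 1]] tendsto_const[of 1]]
    have "(\<lambda>N. \<Sum>n<N. f n s) \<longlonglongrightarrow> (s - 1) * dirichlet_series (\<lambda>_. 1) s - 1"
      using s unfolding part by simp
    then have "g s = (s - 1) * dirichlet_series (\<lambda>_. 1) s - 1"
      using g(2)[of s] s unfolding sums_def by (auto intro: LIMSEQ_unique)
    then show "1 + g s = (s - 1) * dirichlet_series (\<lambda>_. 1) s" by simp
  qed
qed

section \<open>Absolutely convergent Dirichlet series\<close>

definition dirichlet_summable :: "(nat \<Rightarrow> complex) \<Rightarrow> bool"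
  where "dirichlet_summable a \<longleftrightarrow> (\<forall>\<sigma>>1. summable (\<lambda>n. norm (a n) * real n powr - \<sigma>))"

lemma dirichlet_summable_mono:
  assumes "dirichlet_summable b" "\<And>n. norm (a n) \<le> C * norm (b n)"
  shows "dirichlet_summable a"
  unfolding dirichlet_summable_def
proof (intro allI impI)
  fix \<sigma> :: real assume "\<sigma> > 1"
  then have "summable (\<lambda>n. C * (norm (b n) * real n powr - \<sigma>))"
    using assms(1) by (intro summable_mult) (auto simp: dirichlet_summable_def)
  then show "summable (\<lambda>n. norm (a n) * real n powr - \<sigma>)"
    by (rule summable_comparison_test_ev[rotated])
      (use assms(2) in \<open>auto simp: mult.assoc[symmetric] intro!: always_eventually mult_right_mono\<close>)
qed

lemma dirichlet_summable_one: "dirichlet_summable (\<lambda>_. 1)"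
  by (auto simp: dirichlet_summable_def summable_real_powr_iff)

text \<open>Since \<open>ln n <= n powr e / e\<close>, the logarithm costs an arbitrarily small
  power; \<open>e\<close> is half the distance from \<sigma> to 1, so that
  \<open>\<sigma> - e\<close> still exceeds 1.\<close>

lemma dirichlet_summable_ln_mult:
  assumes "dirichlet_summable a"
  shows "dirichlet_summable (\<lambda>n. a n * of_real (ln (real n)))"
  unfolding dirichlet_summable_def
proof (intro allI impI)
  fix \<sigma> :: real assume \<sigma>: "\<sigma> > 1"
  define e where "e = (\<sigma> - 1) / 2"
  have e: "e > 0" using \<sigma> by (simp add: e_def)
  have "\<sigma> - e > 1" using \<sigma> by (simp add: e_def field_simps)
  then have "summable (\<lambda>n. (norm (a n) * real n powr - (\<sigma> - e)) * (1 / e))"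
    using assms by (intro summable_mult2) (auto simp: dirichlet_summable_def)
  moreover have "norm (norm (a n * of_real (ln (real n))) * real n powr - \<sigma>)
      \<le> (norm (a n) * real n powr - (\<sigma> - e)) * (1 / e)" if "n \<ge> 1" for n
  proof -
    have "ln (real n) * real n powr - \<sigma> \<le> (real n powr e / e) * real n powr - \<sigma>"
      using ln_powr_bound[of "real n" e] that e by (intro mult_right_mono) auto
    also have "\<dots> = real n powr - (\<sigma> - e) * (1 / e)"
      using powr_add[of "real n" e "- \<sigma>"] by (simp add: algebra_simps)
    finally have "norm (a n) * (ln (real n) * real n powr - \<sigma>)
        \<le> norm (a n) * (real n powr - (\<sigma> - e) * (1 / e))"
      by (intro mult_left_mono) auto
    then show ?thesis using that by (simp add: norm_mult mult.assoc)
  qed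
  ultimately show "summable (\<lambda>n. norm (a n * of_real (ln (real n))) * real n powr - \<sigma>)"
    by (rule summable_comparison_test_ev[rotated, OF _ eventually_sequentiallyI[of 1]])
qed

text \<open>\<open>mangoldt n\<close> is one term of the nonnegative divisor sum equal to
  \<open>ln n\<close>.\<close>

lemma mangoldt_le_ln: "mangoldt n \<le> ln (real n)" if "n > 0"
proof -
  have "mangoldt n \<le> (\<Sum>d | d dvd n. mangoldt d :: real)"
    by (rule member_le_sum) (use that in \<open>auto intro: mangoldt_nonneg\<close>)
  then show ?thesis using mangoldt_sum[of n, where 'a = real] that by simp
qed

lemma dirichlet_summable_mangoldt_mult:
  assumes "dirichlet_summable a"
  shows "dirichlet_summable (\<lambda>n. a n * mangoldt n)"
proof (rule dirichlet_summable_mono[OF dirichlet_summable_ln_mult[OF assms], where C = 1])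
  fix n
  show "norm (a n * mangoldt n) \<le> 1 * norm (a n * of_real (ln (real n)))"
    using mangoldt_le_ln[of n] mangoldt_nonneg[of n]
    by (cases "n = 0") (auto simp: norm_mult intro!: mult_left_mono)
qed

lemma summable_norm_dirichlet_series:
  assumes "dirichlet_summable a" "Re s > 1"
  shows "summable (\<lambda>n. norm (a n * of_nat n powr (- s)))"
  using assms by (simp add: dirichlet_summable_def norm_mult norm_of_nat_powr)

lemma summable_dirichlet_series:
  assumes "dirichlet_summable a" "Re s > 1"
  shows "summable (\<lambda>n. a n * of_nat n powr (- s))"
  using summable_norm_dirichlet_series[OF assms] by (rule summable_norm_cancel)

lemma dirichlet_series_add:
  assumes "dirichlet_summable a" "dirichlet_summable b" "Re s > 1"
  shows "dirichlet_series (\<lambda>n. a n + b n) s = dirichlet_series a s + dirichlet_series b s"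
  unfolding dirichlet_series_def
  by (subst suminf_add) (auto intro: summable_dirichlet_series assms simp: algebra_simps)

lemma dirichlet_series_diff:
  assumes "dirichlet_summable a" "dirichlet_summable b" "Re s > 1"
  shows "dirichlet_series (\<lambda>n. a n - b n) s = dirichlet_series a s - dirichlet_series b s"
  unfolding dirichlet_series_def
  by (subst suminf_diff) (auto intro: summable_dirichlet_series assms simp: algebra_simps)

lemma has_field_derivative_dirichlet_series:
  assumes a: "dirichlet_summable a" and s: "Re s > 1"
  shows "(dirichlet_series a has_field_derivative
    - dirichlet_series (\<lambda>n. a n * of_real (ln (real n))) s) (at s)"
proof -
  let ?H = "{s. Re s > 1}"
  define f where "f = (\<lambda>n s. a n * of_nat n powr (- s))"
  define f' where "f' = (\<lambda>n s. - (a n * of_real (ln (real n)) * of_nat n powr (- s)))"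
  have "\<exists>g g'. \<forall>x\<in>?H. (\<lambda>n. f n x) sums g x \<and> (\<lambda>n. f' n x) sums g' x
      \<and> (g has_field_derivative g' x) (at x)"
  proof (rule series_and_derivative_comparison_local)
    show "open ?H" by (simp add: open_halfspace_Re_gt)
    show "(f n has_field_derivative f' n x) (at x)" if "x \<in> ?H" for n x
    proof (cases "n = 0")
      case False
      have "((\<lambda>x. of_nat n powr (- x)) has_field_derivative
          (Ln (of_nat n) * of_nat n powr (- x)) * (- 1)) (at x)"
        by (rule DERIV_chain2[OF has_field_derivative_powr_right])
          (use False in \<open>auto intro!: derivative_eq_intros\<close>)
      from DERIV_cmult[OF this, of "a n"] show ?thesis
        using False unfolding f_def f'_def by (simp add: Ln_of_nat mult_ac)
    qed (simp add: f_def f'_def)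
  next
    fix x :: complex assume "x \<in> ?H"
    then have x: "Re x > 1" by simp
    define r where "r = (Re x - 1) / 2"
    have r: "r > 0" using x by (simp add: r_def)
    define h where "h = (\<lambda>n. norm (a n) * real n powr - (1 + r))"
    have "summable h"
      using a[unfolded dirichlet_summable_def, rule_format, of "1 + r"] r unfolding h_def by simp
    moreover have "norm (f n y) \<le> h n" if y: "y \<in> ball x r \<inter> ?H" for n y
    proof -
      have "\<bar>Re x - Re y\<bar> \<le> norm (x - y)"
        using abs_Re_le_cmod[of "x - y"] by simp
      moreover have "norm (x - y) < r"
        using y by (simp add: dist_norm)
      ultimately have "Re y \<ge> 1 + r" unfolding r_def by (simp add: abs_le_iff field_simps)
      then have "real n powr - Re y \<le> real n powr - (1 + r)"
        by (cases "n = 0") (auto intro: powr_mono)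
      then show ?thesis
        unfolding f_def h_def by (simp add: norm_mult norm_of_nat_powr mult_left_mono)
    qed
    ultimately show "\<exists>d h. 0 < d \<and> summable h \<and>
        (\<forall>\<^sub>F n in sequentially. \<forall>y\<in>ball x d \<inter> ?H. norm (f n y) \<le> h n)"
      using r by (intro exI[of _ r] exI[of _ h]) auto
  qed
  then obtain g g' where g: "\<And>x. x \<in> ?H \<Longrightarrow> (\<lambda>n. f n x) sums g x"
      "\<And>x. x \<in> ?H \<Longrightarrow> (\<lambda>n. f' n x) sums g' x"
      "\<And>x. x \<in> ?H \<Longrightarrow> (g has_field_derivative g' x) (at x)"
    by blast
  have "dirichlet_series a x = g x" if "x \<in> ?H" for x
    using g(1)[OF that] unfolding dirichlet_series_def f_def by (simp add: sums_iff)
  moreover have "g' s = - dirichlet_series (\<lambda>n. a n * of_real (ln (real n))) s"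
    using g(2)[of s] s summable_dirichlet_series[OF dirichlet_summable_ln_mult[OF a] s]
    unfolding dirichlet_series_def f'_def by (simp add: sums_iff suminf_minus)
  ultimately show ?thesis
    using has_field_derivative_transform_within_open[of g "g' s" s ?H "dirichlet_series a"] g(3)[of s] s
    by (auto simp: open_halfspace_Re_gt)
qed

text \<open>Insert \<open>ln n\<close> as the sum of \<open>mangoldt m\<close> over m dividing n.
  With n = m k the term becomes \<open>F m * mangoldt m * F k\<close>, and absolute convergence
  allows the sum over pairs to be arranged as a product.\<close>

lemma completely_multiplicative_ln_series:
  fixes F :: "nat \<Rightarrow> complex"
  assumes mult: "\<And>m n. F (m * n) = F m * F n"
    and F: "summable (\<lambda>n. norm (F n))" "F 0 = 0"
    and FL: "summable (\<lambda>n. norm (F n * mangoldt n))"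
  shows "(\<Sum>n. F n * of_real (ln (real n))) = (\<Sum>n. F n * mangoldt n) * (\<Sum>n. F n)"
proof -
  let ?A = "\<lambda>n. F n * mangoldt n"
  have A: "(?A has_sum (\<Sum>n. ?A n)) UNIV"
    by (rule norm_summable_imp_has_sum[OF FL summable_sums[OF summable_norm_cancel[OF FL]]])
  have B: "(F has_sum (\<Sum>n. F n)) UNIV"
    by (rule norm_summable_imp_has_sum[OF F(1) summable_sums[OF summable_norm_cancel[OF F(1)]]])
  \<comment> \<open>Index 0 is removed because every m divides 0; only for positive n do the divisor
    pairs match the pairs of positive factors.\<close>
  have A': "(?A has_sum (\<Sum>n. ?A n)) {0<..}"
    using A by (rule has_sum_cong_neutral[THEN iffD1, rotated -1]) auto
  have B': "(F has_sum (\<Sum>n. F n)) {0<..}"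
    using B by (rule has_sum_cong_neutral[THEN iffD1, rotated -1]) (use F(2) in auto)
  have nA: "(\<lambda>n. norm (?A n)) summable_on {0<..}"
    by (rule summable_on_subset_banach[OF norm_summable_imp_summable_on]) (use FL in auto)
  have nB: "(\<lambda>n. norm (F n)) summable_on {0<..}"
    by (rule summable_on_subset_banach[OF norm_summable_imp_summable_on]) (use F(1) in auto)
  have "(\<lambda>(m, n). norm (?A m) * norm (F n)) summable_on {0<..} \<times> {0<..}"
  proof (rule summable_on_SigmaI)
    show "((\<lambda>n. case (m, n) of (m, n) \<Rightarrow> norm (?A m) * norm (F n)) has_sum
        norm (?A m) * infsum (\<lambda>n. norm (F n)) {0<..}) {0<..}" for m
      unfolding prod.case by (rule has_sum_cmult_right[OF has_sum_infsum[OF nB]])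
    show "(\<lambda>m. norm (?A m) * infsum (\<lambda>n. norm (F n)) {0<..}) summable_on {0<..}"
      by (rule summable_on_cmult_left[OF nA])
  qed simp
  then have "(\<lambda>x. norm (case x of (m, n) \<Rightarrow> ?A m * F n)) summable_on {0<..} \<times> {0<..}"
    by (simp add: case_prod_unfold norm_mult)
  then have "(\<lambda>(m, n). ?A m * F n) summable_on {0<..} \<times> {0<..}"
    by (rule Infinite_Sum.abs_summable_summable)
  then have P: "((\<lambda>(m, n). ?A m * F n) has_sum ((\<Sum>n. ?A n) * (\<Sum>n. F n))) ({0<..} \<times> {0<..})"
  proof (rule has_sum_SigmaI[rotated 2])
    show "((\<lambda>n. case (m, n) of (m, n) \<Rightarrow> ?A m * F n) has_sum ?A m * (\<Sum>n. F n)) {0<..}" for m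
      unfolding prod.case by (rule has_sum_cmult_right[OF B'])
    show "((\<lambda>m. ?A m * (\<Sum>n. F n)) has_sum (\<Sum>n. ?A n) * (\<Sum>n. F n)) {0<..}"
      by (rule has_sum_cmult_left[OF A'])
  qed
  have "((\<lambda>(n, m). F n * mangoldt m) has_sum ((\<Sum>n. ?A n) * (\<Sum>n. F n)))
      (Sigma {0<..} (\<lambda>n. {m. m dvd n}))
    \<longleftrightarrow> ((\<lambda>(m, n). ?A m * F n) has_sum ((\<Sum>n. ?A n) * (\<Sum>n. F n))) ({0<..} \<times> {0<..})"
  proof (rule has_sum_reindex_bij_witness[of _ "\<lambda>(m, k). (m * k, m)" "\<lambda>(n, m). (m, n div m)"])
    fix x :: "nat \<times> nat" assume "x \<in> Sigma {0<..} (\<lambda>n. {m. m dvd n})"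
    then obtain m k where x: "x = (m * k, m)" and mk: "m > 0" "k > 0"
      by (auto elim!: dvdE)
    show "(case case x of (n, m) \<Rightarrow> (m, n div m) of (m, n) \<Rightarrow> ?A m * F n)
        = (case x of (n, m) \<Rightarrow> F n * mangoldt m)"
      using mk by (simp add: x mult ac_simps)
  qed (auto elim!: dvdE)
  with P have "((\<lambda>(n, m). F n * mangoldt m) has_sum ((\<Sum>n. ?A n) * (\<Sum>n. F n)))
      (Sigma {0<..} (\<lambda>n. {m. m dvd n}))" by blast
  then have "((\<lambda>n. F n * of_real (ln (real n))) has_sum ((\<Sum>n. ?A n) * (\<Sum>n. F n))) {0<..}"
  proof (rule has_sum_SigmaD)
    fix n :: nat assume n: "n \<in> {0<..}"
    then have "((\<lambda>m. F n * mangoldt m) has_sum (\<Sum>m | m dvd n. F n * mangoldt m)) {m. m dvd n}"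
      by (intro has_sum_finite) auto
    also have "(\<Sum>m | m dvd n. F n * mangoldt m) = F n * of_real (ln (real n))"
      using n mangoldt_sum[of n, where 'a = complex] by (simp add: sum_distrib_left[symmetric])
    finally show "((\<lambda>m. case (n, m) of (n, m) \<Rightarrow> F n * mangoldt m) has_sum F n * of_real (ln (real n))) {m. m dvd n}"
      by simp
  qed
  then have "((\<lambda>n. F n * of_real (ln (real n))) has_sum ((\<Sum>n. ?A n) * (\<Sum>n. F n))) UNIV"
    by (rule has_sum_cong_neutral[THEN iffD1, rotated -1]) auto
  then show ?thesis
    using has_sum_imp_sums sums_unique by metis
qed

section \<open>Boundary behaviour of logarithmic derivatives\<close>

text \<open>This is the logarithmic derivative multiplied out, so that it also holds where the
  series might vanish.\<close>

lemma deriv_dirichlet_series_completely_multiplicative: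
  assumes mult: "\<And>m n. a (m * n) = a m * a n"
    and a: "dirichlet_summable a" and s: "Re s > 1"
  shows "deriv (dirichlet_series a) s
    = - (dirichlet_series (\<lambda>n. a n * mangoldt n) s * dirichlet_series a s)"
proof -
  define F where "F = (\<lambda>n. a n * of_nat n powr (- s))"
  have eq: "F n * c n = a n * c n * of_nat n powr (- s)" for c :: "nat \<Rightarrow> complex" and n
    by (simp add: F_def)
  have "(\<Sum>n. F n * of_real (ln (real n))) = (\<Sum>n. F n * mangoldt n) * (\<Sum>n. F n)"
  proof (rule completely_multiplicative_ln_series)
    show "F (m * n) = F m * F n" for m n
      by (simp add: F_def mult powr_times_real)
    show "summable (\<lambda>n. norm (F n))"
      unfolding F_def by (rule summable_norm_dirichlet_series[OF a s])
    show "summable (\<lambda>n. norm (F n * mangoldt n))"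
      unfolding eq by (rule summable_norm_dirichlet_series[OF dirichlet_summable_mangoldt_mult[OF a] s])
  qed (simp add: F_def)
  then have "dirichlet_series (\<lambda>n. a n * of_real (ln (real n))) s
      = dirichlet_series (\<lambda>n. a n * mangoldt n) s * dirichlet_series a s"
    by (simp add: dirichlet_series_def F_def mult_ac)
  then show ?thesis
    using DERIV_imp_deriv[OF has_field_derivative_dirichlet_series[OF a s]] by simp
qed

text \<open>Write \<open>g s = (s - s0) ^ m * P s\<close> with \<open>P\<close> zero-free near
  \<open>s0\<close>. Then \<open>g'/g = m / (s - s0) + P'/P\<close>, and multiplying by
  \<open>h = s - s0\<close> isolates the order \<open>m\<close> of the zero. The point
  \<open>w\<close> ensures that \<open>g\<close> is not identically zero on the connected half
  plane, so that this order is finite.\<close>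

lemma log_derivative_limit:
  assumes hol: "g holomorphic_on {s. Re s > 0}" and s0: "Re s0 > 0"
    and nz: "Re w > 0" "g w \<noteq> 0"
  obtains m :: nat
  where "((\<lambda>h. of_real h * (deriv g (s0 + of_real h) / g (s0 + of_real h))) \<longlongrightarrow> of_nat m) (at_right 0)"
    and "\<forall>\<^sub>F h in at_right 0. g (s0 + of_real h) \<noteq> 0"
    and "g s0 \<noteq> 0 \<Longrightarrow> m = 0"
proof -
  let ?H = "{s. Re s > 0}"
  have op: "open ?H" by (simp add: open_halfspace_Re_gt)
  have conn: "connected ?H"
    by (intro convex_connected convex_halfspace_Re_gt)
  define m where "m = nat (zorder g s0)"
  define P where "P = zor_poly g s0"
  have z: "(if g s0 = 0 then zorder g s0 > 0 else zorder g s0 = 0) \<and> (\<exists>r. r > 0 \<and> cball s0 r \<subseteq> ?H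
      \<and> P holomorphic_on cball s0 r \<and> (\<forall>w\<in>cball s0 r. g w = P w * (w - s0) ^ m \<and> P w \<noteq> 0))"
    unfolding P_def m_def by (rule zorder_exist_zero[OF hol op conn]) (use s0 nz in auto)
  then obtain r where r: "r > 0" and Ph: "P holomorphic_on cball s0 r"
    and gP: "\<And>w. w \<in> cball s0 r \<Longrightarrow> g w = P w * (w - s0) ^ m"
    and P0: "\<And>w. w \<in> cball s0 r \<Longrightarrow> P w \<noteq> 0"
    by blast
  have Ph': "P holomorphic_on ball s0 r"
    using Ph by (rule holomorphic_on_subset) auto
  have ev: "\<forall>\<^sub>F h in at_right (0 :: real). 0 < h \<and> h < r"
    using r by (auto simp: eventually_at_right_field)
  have eq: "of_real h * (deriv g (s0 + of_real h) / g (s0 + of_real h))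
      = of_real h * deriv P (s0 + of_real h) / P (s0 + of_real h) + of_nat m"
    and gnz: "g (s0 + of_real h) \<noteq> 0"
    if h: "0 < h \<and> h < r" for h :: real
  proof -
    define w where "w = s0 + of_real h"
    have w: "w \<in> ball s0 r" using h by (simp add: w_def dist_norm)
    have wh: "w - s0 = of_real h" by (simp add: w_def)
    have Pw: "P w \<noteq> 0" and gw: "g w = P w * of_real h ^ m"
      using P0[of w] gP[of w] w wh by auto
    show "g w \<noteq> 0" using Pw gw h by simp
    have "(P has_field_derivative deriv P w) (at w)"
      using holomorphic_derivI[OF Ph' open_ball w] .
    then have "((\<lambda>w. P w * (w - s0) ^ m) has_field_derivative
        deriv P w * (w - s0) ^ m + P w * (of_nat m * (w - s0) ^ (m - 1))) (at w)"
      by (auto intro!: derivative_eq_intros)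
    then have "(g has_field_derivative
        deriv P w * (w - s0) ^ m + P w * (of_nat m * (w - s0) ^ (m - 1))) (at w)"
      by (rule has_field_derivative_transform_within_open[OF _ open_ball w]) (use gP in auto)
    then have "deriv g w = deriv P w * of_real h ^ m + P w * (of_nat m * of_real h ^ (m - 1))"
      using wh by (simp add: DERIV_imp_deriv)
    then show "of_real h * (deriv g w / g w) = of_real h * deriv P w / P w + of_nat m"
      using Pw h by (cases m) (simp_all add: gw field_simps)
  qed
  have "deriv P holomorphic_on ball s0 r"
    using Ph' by (intro holomorphic_deriv) auto
  then have "isCont (deriv P) s0" "isCont P s0"
    using Ph' r by (auto intro!: continuous_on_interior[of "ball s0 r"] holomorphic_on_imp_continuous_on
        simp: interior_open)
  moreover have lim: "((\<lambda>h::real. s0 + of_real h) \<longlongrightarrow> s0) (at_right 0)"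
    by (auto intro!: tendsto_eq_intros)
  ultimately have "((\<lambda>h. of_real h * deriv P (s0 + of_real h) / P (s0 + of_real h) + of_nat m)
      \<longlongrightarrow> of_real 0 * deriv P s0 / P s0 + of_nat m) (at_right 0)"
    using P0[of s0] r
    by (intro tendsto_intros isCont_tendsto_compose[of s0 P] isCont_tendsto_compose[of s0 "deriv P"]) auto
  then have "((\<lambda>h. of_real h * deriv P (s0 + of_real h) / P (s0 + of_real h) + of_nat m)
      \<longlongrightarrow> of_nat m) (at_right 0)" by simp
  then have "((\<lambda>h. of_real h * (deriv g (s0 + of_real h) / g (s0 + of_real h))) \<longlongrightarrow> of_nat m) (at_right 0)"
    by (rule Lim_transform_eventually, use ev in eventually_elim) (simp only: eq)
  moreover have "\<forall>\<^sub>F h in at_right 0. g (s0 + of_real h) \<noteq> 0"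
    using ev by eventually_elim (rule gnz)
  ultimately show ?thesis
    using that z by (auto simp: m_def split: if_splits)
qed

text \<open>The simple-pole part of the series at the boundary point \<open>1 + \<i> \<tau>\<close> of its half plane of
  convergence, read off along the horizontal approach.\<close>

definition edge_limit :: "(nat \<Rightarrow> complex) \<Rightarrow> real \<Rightarrow> complex \<Rightarrow> bool"
  where "edge_limit a \<tau> c \<longleftrightarrow>
    ((\<lambda>h. of_real h * dirichlet_series a (Complex (1 + h) \<tau>)) \<longlongrightarrow> c) (at_right 0)"

lemma Complex_edge: "Complex (1 + h) \<tau> = Complex 1 \<tau> + of_real h"
  by (simp add: complex_eq_iff)

lemma eventually_at_right_pos: "\<forall>\<^sub>F h in at_right (0 :: real). h > 0"
  by (simp add: eventually_at_right_less)

lemma edge_limit_add: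
  assumes "dirichlet_summable a" "dirichlet_summable b" "edge_limit a \<tau> c" "edge_limit b \<tau> c'"
  shows "edge_limit (\<lambda>n. a n + b n) \<tau> (c + c')"
  unfolding edge_limit_def
  by (rule Lim_transform_eventually[OF tendsto_add[OF assms(3,4)[unfolded edge_limit_def]]],
      use eventually_at_right_pos in eventually_elim)
    (simp add: dirichlet_series_add assms(1,2) algebra_simps)

lemma edge_limit_diff:
  assumes "dirichlet_summable a" "dirichlet_summable b" "edge_limit a \<tau> c" "edge_limit b \<tau> c'"
  shows "edge_limit (\<lambda>n. a n - b n) \<tau> (c - c')"
  unfolding edge_limit_def
  by (rule Lim_transform_eventually[OF tendsto_diff[OF assms(3,4)[unfolded edge_limit_def]]],
      use eventually_at_right_pos in eventually_elim)
    (simp add: dirichlet_series_diff assms(1,2) algebra_simps)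

text \<open>For \<open>g s = (s - 1) * zeta s\<close> the logarithmic derivative is
  \<open>1 / (s - 1)\<close> minus the series of \<open>mangoldt\<close>. The first part contributes
  1 at frequency 0 and nothing elsewhere; a zero of order m contributes -m. At s = 1 the order is 0
  because \<open>g 1 = 1\<close>.\<close>

lemma edge_limit_mangoldt:
  assumes \<tau>: "\<tau> \<noteq> 0"
  obtains m :: nat where "edge_limit mangoldt \<tau> (- of_nat m)"
    and "edge_limit mangoldt 0 1"
proof -
  obtain g where g: "g holomorphic_on {s. Re s > 0}" "g 1 = 1"
      "\<And>s. Re s > 1 \<Longrightarrow> summable (\<lambda>n. of_nat n powr (- s) :: complex) \<Longrightarrow>
        g s = (s - 1) * dirichlet_series (\<lambda>_. 1) s"
    using zeta_continuation by blast
  have g_eq: "g s = (s - 1) * dirichlet_series (\<lambda>_. 1) s" if "Re s > 1" for s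
    using g(3)[OF that] summable_dirichlet_series[OF dirichlet_summable_one that] by simp
  have deriv_g: "deriv g s = dirichlet_series (\<lambda>_. 1) s
      - (s - 1) * (dirichlet_series mangoldt s * dirichlet_series (\<lambda>_. 1) s)" if s: "Re s > 1" for s
  proof -
    let ?D = "dirichlet_series (\<lambda>_. 1)"
    have "(?D has_field_derivative deriv ?D s) (at s)"
      using has_field_derivative_dirichlet_series[OF dirichlet_summable_one s]
      by (simp add: DERIV_imp_deriv)
    then have "((\<lambda>s. (s - 1) * ?D s) has_field_derivative ?D s + (s - 1) * deriv ?D s) (at s)"
      by (auto intro!: derivative_eq_intros)
    then have "(g has_field_derivative ?D s + (s - 1) * deriv ?D s) (at s)"
      by (rule has_field_derivative_transform_within_open[of _ _ _ "{s. Re s > 1}"])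
        (use s g_eq in \<open>auto simp: open_halfspace_Re_gt\<close>)
    moreover have "deriv ?D s = - (dirichlet_series mangoldt s * ?D s)"
      using deriv_dirichlet_series_completely_multiplicative[OF _ dirichlet_summable_one s] by simp
    ultimately show ?thesis by (simp add: DERIV_imp_deriv)
  qed
  \<comment> \<open>Both frequencies are treated at once: \<open>c\<close> is the contribution of
    the pole and \<open>m\<close> the order of the zero of \<open>g\<close> at the edge
    point.\<close>
  have lim: "edge_limit mangoldt \<tau> (c - of_nat m)"
    if m: "((\<lambda>h. of_real h * (deriv g (Complex 1 \<tau> + of_real h) / g (Complex 1 \<tau> + of_real h))) \<longlongrightarrow> of_nat m) (at_right 0)"
      "\<forall>\<^sub>F h in at_right 0. g (Complex 1 \<tau> + of_real h) \<noteq> 0"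
    and c: "((\<lambda>h. of_real h / (Complex 0 \<tau> + of_real h)) \<longlongrightarrow> c) (at_right 0)"
    for \<tau> c m
    unfolding edge_limit_def Complex_edge
  proof (rule Lim_transform_eventually[OF tendsto_diff[OF c m(1)]])
    show "\<forall>\<^sub>F h in at_right 0. of_real h / (Complex 0 \<tau> + of_real h)
        - of_real h * (deriv g (Complex 1 \<tau> + of_real h) / g (Complex 1 \<tau> + of_real h))
        = of_real h * dirichlet_series mangoldt (Complex 1 \<tau> + of_real h)"
      using eventually_at_right_pos m(2)
    proof eventually_elim
      case (elim h)
      define s where "s = Complex 1 \<tau> + of_real h"
      have s: "Re s > 1" using elim by (simp add: s_def)
      have s1: "s - 1 = Complex 0 \<tau> + of_real h" by (simp add: s_def complex_eq_iff)
      have "g s \<noteq> 0" using elim by (simp add: s_def)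
      then have "s - 1 \<noteq> 0" "dirichlet_series (\<lambda>_. 1) s \<noteq> 0" using g_eq[OF s] by auto
      then have eq: "deriv g s / g s = 1 / (s - 1) - dirichlet_series mangoldt s"
        unfolding deriv_g[OF s] g_eq[OF s] by (simp add: field_simps)
      then show ?case
        unfolding s_def[symmetric] s1[symmetric] eq by (simp add: algebra_simps)
    qed
  qed
  obtain m where m: "((\<lambda>h. of_real h * (deriv g (Complex 1 \<tau> + of_real h) / g (Complex 1 \<tau> + of_real h))) \<longlongrightarrow> of_nat m) (at_right 0)"
      "\<forall>\<^sub>F h in at_right 0. g (Complex 1 \<tau> + of_real h) \<noteq> 0"
    by (rule log_derivative_limit[OF g(1), of "Complex 1 \<tau>" 1]) (use g(2) in auto)
  have "((\<lambda>h. of_real h / (Complex 0 \<tau> + of_real h)) \<longlongrightarrow> of_real 0 / (Complex 0 \<tau> + of_real 0)) (at_right 0)"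
    using \<tau> by (intro tendsto_intros) (auto simp: complex_eq_iff)
  then have "edge_limit mangoldt \<tau> (0 - of_nat m)"
    by (intro lim[OF m]) simp
  moreover obtain m0 :: nat where m0: "((\<lambda>h. of_real h * (deriv g (Complex 1 0 + of_real h) / g (Complex 1 0 + of_real h))) \<longlongrightarrow> of_nat m0) (at_right 0)"
      "\<forall>\<^sub>F h in at_right 0. g (Complex 1 0 + of_real h) \<noteq> 0" "g (Complex 1 0) \<noteq> 0 \<Longrightarrow> m0 = 0"
    by (rule log_derivative_limit[OF g(1), of "Complex 1 0" 1]) (use g(2) in auto)
  have "Complex 1 0 = 1" by (simp add: complex_eq_iff)
  then have "m0 = 0" using m0(3) g(2) by simp
  have "((\<lambda>h. of_real h / (Complex 0 0 + of_real h)) \<longlongrightarrow> 1) (at_right 0)"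
    by (rule Lim_transform_eventually[OF tendsto_const], use eventually_at_right_pos in eventually_elim)
      (simp add: zero_complex.code[symmetric])
  from lim[OF m0(1,2) this] have "edge_limit mangoldt 0 1"
    using \<open>m0 = 0\<close> by simp
  ultimately show ?thesis using that by simp
qed

section \<open>Nonvanishing on the line of convergence\<close>

text \<open>Bounded partial sums express periodicity together with nonprincipality in the form that
  the continuation consumes. The finiteness condition ensures that primes of value 0 leave no trace
  at the edge.\<close>

locale real_character =
  fixes chi :: "nat \<Rightarrow> int" and B :: real
  assumes mult: "chi (m * n) = chi m * chi n"
    and one: "chi 1 = 1" and zero: "chi 0 = 0"
    and range: "chi n \<in> {-1, 0, 1}"
    and partial_sums: "\<bar>real_of_int (\<Sum>k=1..N. chi k)\<bar> \<le> B"
    and finite_ramified: "finite {p. prime p \<and> chi p = 0}"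
begin

lemma norm_le: "norm (of_int (chi n) :: complex) \<le> 1"
  using range[of n] by auto

lemma summable: "dirichlet_summable (\<lambda>n. of_int (chi n))"
  by (rule dirichlet_summable_mono[OF dirichlet_summable_one, where C = 1]) (use norm_le in auto)

text \<open>One point of nonvanishing shows that the continued L-function is not identically zero.
  At 4 the leading term is 1, and from \<open>n ^ 4 >= 4 * n ^ 2\<close> for n >= 2 the tail is at
  most a quarter of \<open>pi^2 / 6 - 1\<close>, which is below 1.\<close>

lemma dirichlet_series_4: "dirichlet_series (\<lambda>n. of_int (chi n)) 4 \<noteq> 0"
proof -
  define f where "f = (\<lambda>n. of_int (chi n) * of_nat n powr (- 4) :: complex)"
  have nf: "norm (f n) \<le> real n powr (- 4)" for n
    using mult_right_mono[OF norm_le[of n], of "real n powr (- 4)"]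
    by (simp add: f_def norm_mult norm_of_nat_powr)
  have summ: "summable f"
    using summable_dirichlet_series[OF summable, of 4] unfolding f_def by simp
  have "f 0 = 0" "f 1 = 1"
    using one zero by (simp_all add: f_def)
  then have *: "dirichlet_series (\<lambda>n. of_int (chi n)) 4 = (\<Sum>n. f (n + 2)) + 1"
    using suminf_split_initial_segment[OF summ, of 2]
    by (simp add: dirichlet_series_def f_def numeral_2_eq_2)
  have "(\<lambda>n. 1 / (real n + 1)\<^sup>2) sums (pi\<^sup>2 / 6)"
    using inverse_squares_sums by (simp only: of_nat_power of_nat_add of_nat_1)
  then have "(\<lambda>n. 1 / (real (Suc n) + 1)\<^sup>2) sums (pi\<^sup>2 / 6 - 1)"
    by (subst sums_Suc_iff) simp
  then have sq: "(\<lambda>n. 1 / 4 * (1 / (real (Suc n) + 1)\<^sup>2)) sums (1 / 4 * (pi\<^sup>2 / 6 - 1))"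
    by (rule sums_mult)
  have le: "norm (f (n + 2)) \<le> 1 / 4 * (1 / (real (Suc n) + 1)\<^sup>2)" for n
  proof -
    have "real (n + 2) powr (- 4) = 1 / ((real (Suc n) + 1)\<^sup>2 * (real (Suc n) + 1)\<^sup>2)"
      by (simp add: powr_minus powr_numeral field_simps flip: power_add)
    also have "\<dots> \<le> 1 / (4 * (real (Suc n) + 1)\<^sup>2)"
      using power_mono[of 2 "real (Suc n) + 1" 2]
      by (intro divide_left_mono mult_right_mono) auto
    finally show ?thesis using nf[of "n + 2"] by simp
  qed
  have "norm (\<Sum>n. f (n + 2)) \<le> 1 / 4 * (pi\<^sup>2 / 6 - 1)"
    using norm_suminf_le[of "\<lambda>n. f (n + 2)", OF le] sq by (simp add: sums_iff)
  also have "\<dots> < 1"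
  proof -
    have "pi * pi < 4 * 4"
      using pi_less_4 pi_gt_zero by (intro mult_strict_mono) auto
    then show ?thesis by (simp add: power2_eq_square)
  qed
  finally have "norm (\<Sum>n. f (n + 2)) < 1" .
  then show ?thesis
    unfolding * by (auto simp flip: eq_neg_iff_add_eq_0)
qed

text \<open>The continuation of L is holomorphic across the whole edge, 1 included, so its
  logarithmic derivative can only record zeros. Here \<open>m\<close> is the order of the zero at
  \<open>1 + i \<tau>\<close>, for \<tau> = 0 as well.\<close>

lemma edge_limit_twisted:
  obtains m :: nat where "edge_limit (\<lambda>n. of_int (chi n) * mangoldt n) \<tau> (- of_nat m)"
proof -
  let ?D = "dirichlet_series (\<lambda>n. of_int (chi n))"
  have "norm (\<Sum>k=1..N. of_int (chi k) :: complex) \<le> B" for N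
    using partial_sums[of N] by (simp flip: of_int_sum)
  from dirichlet_series_continuation[OF this] obtain g
    where g: "g holomorphic_on {s. Re s > 0}"
      "\<And>s. Re s > 0 \<Longrightarrow> summable (\<lambda>n. of_int (chi n) * of_nat n powr (- s) :: complex) \<Longrightarrow> g s = ?D s"
    by blast
  have g_eq: "g s = ?D s" if "Re s > 1" for s
    using g(2)[of s] summable_dirichlet_series[OF summable that] that by simp
  have deriv_g: "deriv g s = - (dirichlet_series (\<lambda>n. of_int (chi n) * mangoldt n) s * g s)"
    if s: "Re s > 1" for s
  proof -
    have "\<forall>\<^sub>F z in nhds s. g z = ?D z"
      by (rule eventually_nhds_in_open[of "{s. Re s > 1}", THEN eventually_mono])
        (use s g_eq in \<open>auto simp: open_halfspace_Re_gt\<close>)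
    then have "deriv g s = deriv ?D s" by (rule deriv_cong_ev) simp
    then show ?thesis
      using deriv_dirichlet_series_completely_multiplicative[OF _ summable s] g_eq[OF s]
      by (simp add: mult)
  qed
  obtain m where m: "((\<lambda>h. of_real h * (deriv g (Complex 1 \<tau> + of_real h) / g (Complex 1 \<tau> + of_real h))) \<longlongrightarrow> of_nat m) (at_right 0)"
      "\<forall>\<^sub>F h in at_right 0. g (Complex 1 \<tau> + of_real h) \<noteq> 0"
    by (rule log_derivative_limit[OF g(1), of "Complex 1 \<tau>" 4])
      (use g_eq[of 4] dirichlet_series_4 in auto)
  have "edge_limit (\<lambda>n. of_int (chi n) * mangoldt n) \<tau> (- of_nat m)"
    unfolding edge_limit_def Complex_edge
    by (rule Lim_transform_eventually[OF tendsto_minus[OF m(1)]],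
        use eventually_at_right_pos m(2) in eventually_elim) (simp add: deriv_g)
  then show ?thesis by (rule that)
qed

end

section \<open>The inequality of Mertens for nonnegative coefficients\<close>

lemma of_nat_powr_Complex:
  "(of_nat n :: complex) powr (- Complex \<sigma> \<tau>) = of_real (real n powr - \<sigma>) * cis (- \<tau> * ln (real n))"
proof (cases "n = 0")
  case False
  then have "(of_nat n :: complex) powr (- Complex \<sigma> \<tau>) = exp (- Complex \<sigma> \<tau> * of_real (ln (real n)))"
    by (simp add: powr_def Ln_of_nat)
  also have "\<dots> = of_real (exp (- \<sigma> * ln (real n))) * cis (- \<tau> * ln (real n))"
    by (simp add: exp_eq_polar complex_eq_iff)
  finally show ?thesis using False by (simp add: powr_def)
qed simp

text \<open>With \<open>x = \<tau> * ln n\<close> the n-th term has real part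
  \<open>u n * n powr - \<sigma>\<close> times
  \<open>3 + 4 cos x + cos 2x = 2 (1 + cos x)^2\<close>.\<close>

lemma dirichlet_series_3_4_1:
  fixes u :: "nat \<Rightarrow> real"
  assumes u: "\<And>n. u n \<ge> 0" "dirichlet_summable (\<lambda>n. of_real (u n))" and \<sigma>: "\<sigma> > 1"
  defines "D \<equiv> \<lambda>\<tau>. dirichlet_series (\<lambda>n. of_real (u n)) (Complex \<sigma> \<tau>)"
  shows "Re (3 * D 0 + 4 * D \<tau> + D (2 * \<tau>)) \<ge> 0"
proof -
  define f where "f = (\<lambda>\<tau> n. of_real (u n) * of_nat n powr (- Complex \<sigma> \<tau>) :: complex)"
  have f: "summable (f \<tau>)" for \<tau>
    using summable_dirichlet_series[OF u(2), of "Complex \<sigma> \<tau>"] \<sigma> by (simp add: f_def)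
  have "f \<tau> sums D \<tau>" for \<tau>
    using summable_sums[OF f, of \<tau>] by (simp add: D_def f_def dirichlet_series_def)
  then have "(\<lambda>n. Re (3 * f 0 n + 4 * f \<tau> n + f (2 * \<tau>) n)) sums Re (3 * D 0 + 4 * D \<tau> + D (2 * \<tau>))"
    by (intro sums_Re sums_add sums_mult)
  moreover have "Re (3 * f 0 n + 4 * f \<tau> n + f (2 * \<tau>) n) \<ge> 0" for n
  proof -
    define x where "x = \<tau> * ln (real n)"
    have "Re (3 * f 0 n + 4 * f \<tau> n + f (2 * \<tau>) n)
        = u n * real n powr - \<sigma> * (3 + 4 * cos x + cos (2 * x))"
      by (simp add: f_def of_nat_powr_Complex x_def algebra_simps)
    also have "3 + 4 * cos x + cos (2 * x) = 2 * (1 + cos x)\<^sup>2"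
      unfolding cos_double_cos by (simp add: power2_eq_square algebra_simps)
    finally show ?thesis using u(1)[of n] by simp
  qed
  ultimately show ?thesis by (rule sums_le[OF _ sums_zero, rotated])
qed

lemma edge_limit_3_4_1:
  fixes u :: "nat \<Rightarrow> real"
  assumes "\<And>n. u n \<ge> 0" "dirichlet_summable (\<lambda>n. of_real (u n))"
    and "edge_limit (\<lambda>n. of_real (u n)) 0 c0" "edge_limit (\<lambda>n. of_real (u n)) \<tau> c1"
      "edge_limit (\<lambda>n. of_real (u n)) (2 * \<tau>) c2"
  shows "Re (3 * c0 + 4 * c1 + c2) \<ge> 0"
proof (rule tendsto_lowerbound)
  let ?D = "\<lambda>\<tau> h. of_real h * dirichlet_series (\<lambda>n. of_real (u n)) (Complex (1 + h) \<tau>)"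
  show "((\<lambda>h. Re (3 * ?D 0 h + 4 * ?D \<tau> h + ?D (2 * \<tau>) h)) \<longlongrightarrow> Re (3 * c0 + 4 * c1 + c2)) (at_right 0)"
    using assms(3-5) unfolding edge_limit_def by (intro tendsto_intros)
  show "\<forall>\<^sub>F h in at_right 0. Re (3 * ?D 0 h + 4 * ?D \<tau> h + ?D (2 * \<tau>) h) \<ge> 0"
    using eventually_at_right_pos
  proof eventually_elim
    case (elim h)
    let ?E = "\<lambda>\<tau>. dirichlet_series (\<lambda>n. of_real (u n)) (Complex (1 + h) \<tau>)"
    have "3 * ?D 0 h + 4 * ?D \<tau> h + ?D (2 * \<tau>) h = of_real h * (3 * ?E 0 + 4 * ?E \<tau> + ?E (2 * \<tau>))"
      by (simp add: algebra_simps)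
    then have "Re (3 * ?D 0 h + 4 * ?D \<tau> h + ?D (2 * \<tau>) h) = h * Re (3 * ?E 0 + 4 * ?E \<tau> + ?E (2 * \<tau>))"
      by (simp only: Re_complex_of_real Im_complex_of_real times_complex.sel)
    then show ?case
      using dirichlet_series_3_4_1[OF assms(1,2), of "1 + h" \<tau>] elim by simp
  qed
qed simp

lemma dirichlet_summable_mangoldt: "dirichlet_summable mangoldt"
  using dirichlet_summable_mangoldt_mult[OF dirichlet_summable_one] by simp

context real_character
begin

lemma summable_twisted: "dirichlet_summable (\<lambda>n. of_int (chi n) * mangoldt n)"
  by (rule dirichlet_summable_mangoldt_mult[OF summable])

text \<open>The weights \<open>(1 + chi n) * mangoldt n\<close>, which belong to zeta times L, are
  nonnegative. The inequality reads \<open>3 (1 - n0) - 4 (m1 + n1) - (m2 + n2) >= 0\<close> in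
  natural numbers; since 3 < 4, it forces \<open>m1 = n1 = 0\<close>.\<close>

lemma edge_limit_nonzero_frequency:
  assumes \<tau>: "\<tau> \<noteq> 0"
  shows "edge_limit mangoldt \<tau> 0" and "edge_limit (\<lambda>n. of_int (chi n) * mangoldt n) \<tau> 0"
proof -
  obtain m1 :: nat where m1: "edge_limit mangoldt \<tau> (- of_nat m1)" "edge_limit mangoldt 0 1"
    using edge_limit_mangoldt[OF \<tau>] by blast
  obtain m2 :: nat where m2: "edge_limit mangoldt (2 * \<tau>) (- of_nat m2)"
    using edge_limit_mangoldt[of "2 * \<tau>"] \<tau> by auto
  obtain n0 :: nat where n0: "edge_limit (\<lambda>n. of_int (chi n) * mangoldt n) 0 (- of_nat n0)"
    using edge_limit_twisted by blast
  obtain n1 :: nat where n1: "edge_limit (\<lambda>n. of_int (chi n) * mangoldt n) \<tau> (- of_nat n1)"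
    using edge_limit_twisted by blast
  obtain n2 :: nat where n2: "edge_limit (\<lambda>n. of_int (chi n) * mangoldt n) (2 * \<tau>) (- of_nat n2)"
    using edge_limit_twisted by blast
  define u where "u = (\<lambda>n. (1 + of_int (chi n)) * mangoldt n :: real)"
  have u0: "u n \<ge> 0" for n
    using range[of n] mangoldt_nonneg[of n] by (auto simp: u_def)
  have u: "of_real (u n) = mangoldt n + of_int (chi n) * (mangoldt n :: complex)" for n
    by (simp add: u_def distrib_right)
  note add = edge_limit_add[OF dirichlet_summable_mangoldt summable_twisted]
  have summ: "dirichlet_summable (\<lambda>n. of_real (u n))"
  proof (rule dirichlet_summable_mono[OF dirichlet_summable_mangoldt, where C = 2])
    show "norm (of_real (u n) :: complex) \<le> 2 * norm (mangoldt n :: complex)" for n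
      using range[of n] mangoldt_nonneg[of n] by (auto simp: u_def)
  qed
  have "Re (3 * (1 + - of_nat n0) + 4 * (- of_nat m1 + - of_nat n1) + (- of_nat m2 + - of_nat n2)) \<ge> 0"
    by (rule edge_limit_3_4_1[OF u0 summ, of _ \<tau>]; unfold u; rule add; fact)
  then have "m1 = 0 \<and> n1 = 0" by simp
  then show "edge_limit mangoldt \<tau> 0" "edge_limit (\<lambda>n. of_int (chi n) * mangoldt n) \<tau> 0"
    using m1 n1 by simp_all
qed

end

section \<open>Density of the phases of inert primes\<close>

text \<open>Only powers p^k with k >= 2 remain. For fixed p they form a geometric series with sum at
  most \<open>2 * ln p / p^2\<close>, which is summable over p. Thus passing from
  \<open>mangoldt\<close> to primes alone changes nothing at the edge.\<close>

lemma summable_mangoldt_nonprime: "summable (\<lambda>n. if prime n then 0 else mangoldt n / real n)"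
proof -
  define P where "P = {p :: nat. prime p}"
  define f where "f = (\<lambda>(p, k). ln (real p) / real p ^ (k + 2))"
  define c where "c = (\<lambda>p. ln (real p) / real p ^ 2 * (1 / (1 - 1 / real p)))"
  have inner: "((\<lambda>k. f (p, k)) has_sum c p) UNIV" if "p \<in> P" for p
  proof -
    have p: "p \<ge> 2" using that by (simp add: P_def prime_ge_2_nat)
    have "(\<lambda>k. (1 / real p) ^ k) sums (1 / (1 - 1 / real p))"
      using p by (intro geometric_sums) auto
    then have "(\<lambda>k. ln (real p) / real p ^ 2 * (1 / real p) ^ k) sums c p"
      unfolding c_def by (rule sums_mult)
    moreover have "ln (real p) / real p ^ 2 * (1 / real p) ^ k = f (p, k)" for k
      by (simp add: f_def power_add power_divide power2_eq_square)
    ultimately have s: "(\<lambda>k. f (p, k)) sums c p" by simp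
    moreover have "norm (f (p, k)) = f (p, k)" for k
      using p by (simp add: f_def)
    ultimately show ?thesis
      by (intro norm_summable_imp_has_sum) (auto simp: sums_iff)
  qed
  have "summable (\<lambda>n. norm (1 * of_real (ln (real n)) :: complex) * real n powr - 2)"
    using dirichlet_summable_ln_mult[OF dirichlet_summable_one] unfolding dirichlet_summable_def
    by (elim allE[of _ 2]) simp
  then have "summable (\<lambda>n. 2 * (\<bar>ln (real n)\<bar> * real n powr - 2))"
    by (intro summable_mult) simp
  then have "summable (\<lambda>n. norm (c n))"
  proof (rule summable_comparison_test_ev[rotated], intro eventually_sequentiallyI[of 2])
    fix n :: nat assume n: "n \<ge> 2"
    have "1 / (1 - 1 / real n) \<le> 2"
      using n by (simp add: field_simps)
    then have "ln (real n) / real n ^ 2 * (1 / (1 - 1 / real n)) \<le> ln (real n) / real n ^ 2 * 2"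
      using n by (intro mult_left_mono) auto
    moreover have "real n powr - 2 = 1 / real n ^ 2"
      using n by (simp add: powr_minus powr_numeral field_simps)
    ultimately show "norm (norm (c n)) \<le> 2 * (\<bar>ln (real n)\<bar> * real n powr - 2)"
      using n by (simp add: c_def mult.commute)
  qed
  then have "c summable_on P"
    using norm_summable_imp_summable_on[of c] summable_on_subset_banach[of c UNIV P] by simp
  then have "f summable_on Sigma P (\<lambda>_. UNIV)"
    using inner by (intro summable_on_SigmaI[where g = c]) 
      (auto simp: f_def P_def intro!: divide_nonneg_nonneg ln_ge_zero dest: prime_ge_1_nat)
  moreover define g where "g = (\<lambda>(p :: nat, k :: nat). p ^ (k + 2))"
  have "inj_on g (P \<times> UNIV)"
  proof (rule inj_onI)
    fix x y assume xy: "x \<in> P \<times> UNIV" "y \<in> P \<times> UNIV" "g x = g y"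
    obtain p k q l where "x = (p, k)" "y = (q, l)" by fastforce
    with xy show "x = y"
      using prime_power_inj''[of p q "k + 2" "l + 2"] by (simp add: g_def P_def)
  qed
  moreover have "f x = mangoldt (g x) / real (g x)" if "x \<in> P \<times> UNIV" for x
    using that by (auto simp: f_def g_def P_def mangoldt_primepow simp del: power_Suc)
  ultimately have "(\<lambda>n. mangoldt n / real n) summable_on g ` (P \<times> UNIV)"
    by (subst summable_on_reindex) (auto cong: summable_on_cong)
  also have "?this \<longleftrightarrow> (\<lambda>n. if prime n then 0 else mangoldt n / real n) summable_on UNIV"
  proof (rule summable_on_cong_neutral)
    fix n assume n: "n \<in> UNIV - g ` (P \<times> UNIV)"
    show "(if prime n then 0 else mangoldt n / real n) = 0"
    proof (cases "primepow n")
      case True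
      then obtain p k where pk: "prime p" "k > 0" "n = p ^ k" by (auto simp: primepow_def)
      \<comment> \<open>Exponents from 2 on are all in the image of \<open>g\<close>, so a prime
        power outside it is a prime.\<close>
      have "k = 1"
      proof (rule ccontr)
        assume "k \<noteq> 1"
        then have "k - 2 + 2 = k" using pk by simp
        then have "n = g (p, k - 2)" using pk by (simp only: g_def prod.case)
        then show False using n pk by (auto simp: P_def)
      qed
      then show ?thesis using pk by simp
    qed (simp add: mangoldt_def)
  next
    fix n assume "n \<in> g ` (P \<times> UNIV) \<inter> UNIV"
    then obtain p k where "prime p" "n = p ^ (k + 2)" by (auto simp: g_def P_def)
    then have "\<not> prime n" by (simp add: prime_power_iff del: power_Suc add_2_eq_Suc')
    then show "mangoldt n / real n = (if prime n then 0 else mangoldt n / real n)" by simp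
  qed simp
  finally show ?thesis by (rule summable_on_imp_summable)
qed

text \<open>Absolute convergence at s = 1 keeps the series bounded up to the edge, and the factor h
  then sends the product to 0.\<close>

lemma edge_limit_zero:
  assumes a: "summable (\<lambda>n. norm (a n) / real n)"
  shows "edge_limit a \<tau> 0"
proof -
  define C where "C = (\<Sum>n. norm (a n) / real n)"
  have bound: "norm (dirichlet_series a (Complex (1 + h) \<tau>)) \<le> C" if h: "h > 0" for h
    unfolding dirichlet_series_def C_def
  proof (rule norm_suminf_le[OF _ a])
    fix n
    have "real n powr - (1 + h) \<le> real n powr - 1"
    proof (cases "n = 0")
      case False
      then show ?thesis using h by (intro powr_mono) auto
    qed simp
    also have "\<dots> = 1 / real n"
      by (simp add: powr_minus field_simps)
    finally have "norm (a n) * real n powr - (1 + h) \<le> norm (a n) * (1 / real n)"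
      by (rule mult_left_mono) simp
    then show "norm (a n * of_nat n powr - Complex (1 + h) \<tau>) \<le> norm (a n) / real n"
      by (simp add: norm_mult norm_of_nat_powr)
  qed
  show ?thesis
    unfolding edge_limit_def
  proof (rule Lim_null_comparison)
    show "\<forall>\<^sub>F h in at_right 0. norm (of_real h * dirichlet_series a (Complex (1 + h) \<tau>)) \<le> h * C"
      using eventually_at_right_pos
      by eventually_elim (use bound in \<open>auto simp: norm_mult intro!: mult_left_mono\<close>)
    show "((\<lambda>h. h * C) \<longlongrightarrow> 0) (at_right 0)"
      by (auto intro!: tendsto_eq_intros)
  qed
qed

section \<open>The series over inert primes\<close>

context real_character
begin

text \<open>The factor 2 is the value of \<open>1 - chi\<close> at an inert prime, so this is the
  part of \<open>(1 - chi n) * mangoldt n\<close> that matters at the edge.\<close>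

definition inert_weight :: "nat \<Rightarrow> real"
  where "inert_weight n = (if prime n \<and> chi n = -1 then 2 * ln (real n) else 0)"

lemma inert_weight_nonneg: "inert_weight n \<ge> 0"
  by (auto simp: inert_weight_def intro!: ln_ge_zero dest: prime_ge_1_nat)

lemma summable_inert_weight: "dirichlet_summable (\<lambda>n. of_real (inert_weight n))"
proof (rule dirichlet_summable_mono[OF dirichlet_summable_mangoldt, where C = 2])
  show "norm (of_real (inert_weight n) :: complex) \<le> 2 * norm (mangoldt n :: complex)" for n
    using mangoldt_nonneg[of n] inert_weight_nonneg[of n] by (auto simp: inert_weight_def)
qed

lemma edge_limit_inert_weight:
  assumes "edge_limit mangoldt \<tau> c" "edge_limit (\<lambda>n. of_int (chi n) * mangoldt n) \<tau> c'"
  shows "edge_limit (\<lambda>n. of_real (inert_weight n)) \<tau> (c - c')"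
proof -
  define r where "r = (\<lambda>n. (1 - real_of_int (chi n)) * mangoldt n - inert_weight n)"
  let ?R = "{p. prime p \<and> chi p = 0}"
  \<comment> \<open>At primes with \<open>chi = 1\<close> or \<open>chi = -1\<close> the difference
    \<open>r\<close> is 0. It lives on proper prime powers, where \<open>1 - chi\<close> is at most
    2, and on the finitely many primes with \<open>chi = 0\<close>.\<close>
  have r: "\<bar>r n\<bar> / real n \<le> 2 * (if prime n then 0 else mangoldt n / real n)
      + (if n \<in> ?R then mangoldt n / real n else 0)" for n
    using range[of n] mangoldt_nonneg[of n]
    by (auto simp: r_def inert_weight_def intro!: divide_right_mono)
  have "summable (\<lambda>n. 2 * (if prime n then 0 else mangoldt n / real n)
      + (if n \<in> ?R then mangoldt n / real n else 0))"
    using finite_ramified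
    by (intro summable_add summable_mult summable_mangoldt_nonprime summable_If_finite_set)
  then have "Series.summable (\<lambda>n. norm (of_real (r n) :: complex) / real n)"
    by (rule summable_comparison_test_ev[rotated]) (use r in \<open>auto intro!: always_eventually\<close>)
  then have *: "edge_limit (\<lambda>n. of_real (r n)) \<tau> 0"
    by (rule edge_limit_zero)
  have eq: "of_real (inert_weight n)
      = (mangoldt n - of_int (chi n) * mangoldt n) - (of_real (r n) :: complex)" for n
    by (simp add: r_def algebra_simps)
  have diff: "dirichlet_summable (\<lambda>n. mangoldt n - of_int (chi n) * mangoldt n)"
  proof (rule dirichlet_summable_mono[OF dirichlet_summable_mangoldt, where C = 2])
    fix n
    have "chi n = -1 \<or> chi n = 0 \<or> chi n = 1" using range[of n] by auto
    then show "norm (mangoldt n - of_int (chi n) * mangoldt n :: complex) \<le> 2 * norm (mangoldt n :: complex)"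
      using mangoldt_nonneg[of n] by (elim disjE) (simp_all flip: mult_2 add: norm_mult)
  qed
  have summ_r: "dirichlet_summable (\<lambda>n. of_real (r n))"
  proof (rule dirichlet_summable_mono[OF dirichlet_summable_mangoldt, where C = 2])
    show "norm (of_real (r n) :: complex) \<le> 2 * norm (mangoldt n :: complex)" for n
      using range[of n] mangoldt_nonneg[of n] by (auto simp: r_def inert_weight_def)
  qed
  have "edge_limit (\<lambda>n. (mangoldt n - of_int (chi n) * mangoldt n) - of_real (r n)) \<tau> (c - c' - 0)"
    by (intro edge_limit_diff[OF diff summ_r]
        edge_limit_diff[OF dirichlet_summable_mangoldt summable_twisted] assms *)
  then show ?thesis by (simp add: eq)
qed

text \<open>Fejer's kernel: if no inert prime had its phase near \<open>\<alpha>\<close>, the sum of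
  \<open>\<bar>\<Sum>j<K. z\<^sup>j\<bar>\<^sup>2\<close> over inert primes, which has mean \<open>K\<close>, would stay bounded in \<open>K\<close>.\<close>

theorem inert_phase_dense:
  assumes \<tau>: "\<tau> \<noteq> 0" and \<eta>: "\<eta> > 0"
  shows "\<exists>p. prime p \<and> chi p = -1 \<and> norm (cis (\<tau> * ln (real p) - \<alpha>) - 1) < \<eta>"
proof (rule ccontr)
  assume neg: "\<not> ?thesis"
  let ?w = "inert_weight"
  define z where "z = (\<lambda>n. cis (\<tau> * ln (real n) - \<alpha>))"
  \<comment> \<open>Away from phase \<alpha> the kernel is at most \<open>4 / \<eta>^2\<close>,
    while its mean is \<open>K\<close>; any \<open>K\<close> above that bound gives the
    contradiction.\<close>
  define K where "K = nat \<lfloor>4 / \<eta>\<^sup>2\<rfloor> + 1"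
  have K: "real K > 4 / \<eta>\<^sup>2"
    unfolding K_def by linarith
  define D where "D = (\<lambda>\<sigma> t. dirichlet_series (\<lambda>n. of_real (?w n)) (Complex \<sigma> t))"
  define e where "e = (\<lambda>j k :: nat. (real j - real k))"
  have off: "(norm (\<Sum>j<K. z n ^ j))\<^sup>2 \<le> 4 / \<eta>\<^sup>2" if "?w n \<noteq> 0" for n
  proof -
    have far: "norm (z n - 1) \<ge> \<eta>"
      using that neg by (auto simp: inert_weight_def z_def not_less split: if_splits)
    then have z1: "z n \<noteq> 1" using \<eta> by auto
    have "norm (\<Sum>j<K. z n ^ j) = norm (z n ^ K - 1) / norm (z n - 1)"
      using geometric_sum[OF z1, of K] by (simp add: norm_divide)
    also have "\<dots> \<le> 2 / \<eta>"
    proof (rule frac_le)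
      show "norm (z n ^ K - 1) \<le> 2"
        using norm_triangle_ineq4[of "z n ^ K" 1] by (simp add: z_def norm_power)
    qed (use far \<eta> in auto)
    finally have "(norm (\<Sum>j<K. z n ^ j))\<^sup>2 \<le> (2 / \<eta>)\<^sup>2"
      by (intro power_mono) auto
    then show ?thesis by (simp add: power_divide)
  qed
  \<comment> \<open>The squared kernel \<open>|sum of z^j|^2\<close>, summed against
    \<open>inert_weight n * n powr - \<sigma>\<close> and expanded into its frequencies. The powers
    in the series carry the phase \<open>- t * ln n\<close>, hence the sign in
    \<open>t = - e j k * \<tau>\<close>.\<close>
  define G where "G = (\<lambda>\<sigma>. \<Sum>j<K. \<Sum>k<K. cis (- e j k * \<alpha>) * D \<sigma> (- e j k * \<tau>))"
  have G_le: "Re (G \<sigma>) \<le> 4 / \<eta>\<^sup>2 * Re (D \<sigma> 0)" if \<sigma>: "\<sigma> > 1" for \<sigma>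
  proof -
    define f where "f = (\<lambda>t n. of_real (?w n) * of_nat n powr (- Complex \<sigma> t) :: complex)"
    have f: "f t sums D \<sigma> t" for t
      using summable_sums[OF summable_dirichlet_series[OF summable_inert_weight, of "Complex \<sigma> t"]] \<sigma>
      by (simp add: D_def f_def dirichlet_series_def)
    have "(\<lambda>n. \<Sum>j<K. \<Sum>k<K. cis (- e j k * \<alpha>) * f (- e j k * \<tau>) n) sums G \<sigma>"
      unfolding G_def by (intro sums_sum sums_mult f)
    then have 1: "(\<lambda>n. Re (\<Sum>j<K. \<Sum>k<K. cis (- e j k * \<alpha>) * f (- e j k * \<tau>) n)) sums Re (G \<sigma>)"
      by (rule sums_Re)
    have 2: "(\<lambda>n. 4 / \<eta>\<^sup>2 * Re (f 0 n)) sums (4 / \<eta>\<^sup>2 * Re (D \<sigma> 0))"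
      by (intro sums_mult sums_Re f)
    have "Re (\<Sum>j<K. \<Sum>k<K. cis (- e j k * \<alpha>) * f (- e j k * \<tau>) n) \<le> 4 / \<eta>\<^sup>2 * Re (f 0 n)" for n
    proof -
      define v where "v = ?w n * real n powr - \<sigma>"
      have v: "v \<ge> 0" unfolding v_def using inert_weight_nonneg by simp
      define x where "x = \<tau> * ln (real n) - \<alpha>"
      have pow: "z n ^ j = cis (real j * x)" for j
        by (simp add: z_def x_def Complex.DeMoivre)
      have "cis (- e j k * \<alpha>) * f (- e j k * \<tau>) n = of_real v * (z n ^ j * cnj (z n ^ k))" for j k
      proof -
        have "- e j k * \<alpha> + - (- e j k * \<tau>) * ln (real n) = real j * x + - (real k * x)"
          by (simp add: e_def x_def algebra_simps)
        then have "cis (- e j k * \<alpha>) * cis (- (- e j k * \<tau>) * ln (real n)) = z n ^ j * cnj (z n ^ k)"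
          unfolding pow cis_cnj cis_mult by (simp only:)
        then show ?thesis
          unfolding f_def of_nat_powr_Complex v_def of_real_mult by (simp only: mult_ac)
      qed
      then have "(\<Sum>j<K. \<Sum>k<K. cis (- e j k * \<alpha>) * f (- e j k * \<tau>) n)
          = of_real v * ((\<Sum>j<K. z n ^ j) * cnj (\<Sum>k<K. z n ^ k))"
        by (simp only: cnj_sum sum_product) (simp only: sum_distrib_left)
      also have "\<dots> = of_real (v * (norm (\<Sum>j<K. z n ^ j))\<^sup>2)"
        by (simp only: complex_norm_square[symmetric] of_real_mult)
      finally have "Re (\<Sum>j<K. \<Sum>k<K. cis (- e j k * \<alpha>) * f (- e j k * \<tau>) n)
          = v * (norm (\<Sum>j<K. z n ^ j))\<^sup>2" by simp
      also have "\<dots> \<le> v * (4 / \<eta>\<^sup>2)"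
      proof (cases "?w n = 0")
        case False
        then show ?thesis using off v by (intro mult_left_mono)
      qed (simp add: v_def)
      also have "v = Re (f 0 n)"
        by (simp add: f_def v_def of_nat_powr_Complex)
      finally show ?thesis by (simp add: mult.commute)
    qed
    from sums_le[OF this 1 2] show ?thesis .
  qed
  obtain m :: nat where m: "edge_limit (\<lambda>n. of_int (chi n) * mangoldt n) 0 (- of_nat m)"
    using edge_limit_twisted by blast
  have "edge_limit mangoldt 0 1"
    using edge_limit_mangoldt[OF \<tau>] by blast
  then have zero: "((\<lambda>h. of_real h * D (1 + h) 0) \<longlongrightarrow> 1 + of_nat m) (at_right 0)"
    using edge_limit_inert_weight[OF _ m] unfolding edge_limit_def D_def by fastforce
  have nonzero: "((\<lambda>h. of_real h * D (1 + h) t) \<longlongrightarrow> 0) (at_right 0)" if "t \<noteq> 0" for t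
    using edge_limit_inert_weight[OF edge_limit_nonzero_frequency[OF that]]
    unfolding edge_limit_def D_def by simp
  \<comment> \<open>Off the diagonal the frequency is nonzero and the limit is 0. Each of the
    \<open>K\<close> diagonal terms gives \<open>1 + m\<close>, the same positive number that
    multiplies \<open>4 / \<eta>^2\<close> on the other side.\<close>
  have "((\<lambda>h. \<Sum>j<K. \<Sum>k<K. cis (- e j k * \<alpha>) * (of_real h * D (1 + h) (- e j k * \<tau>)))
      \<longlongrightarrow> (\<Sum>j<K. \<Sum>k<K. if j = k then 1 + of_nat m else 0)) (at_right 0)"
  proof (intro tendsto_sum)
    fix j k
    show "((\<lambda>h. cis (- e j k * \<alpha>) * (of_real h * D (1 + h) (- e j k * \<tau>)))
      \<longlongrightarrow> (if j = k then 1 + of_nat m else 0)) (at_right 0)"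
    proof (cases "j = k")
      case True
      then show ?thesis using zero by (simp add: e_def)
    next
      case False
      then have "- e j k * \<tau> \<noteq> 0" using \<tau> by (simp add: e_def)
      from tendsto_mult_right_zero[OF nonzero[OF this]] show ?thesis using False by simp
    qed
  qed
  also have "(\<Sum>j<K. \<Sum>k<K. if j = k then 1 + of_nat m else (0 :: complex)) = of_nat K * (1 + of_nat m)"
    by (simp add: sum.delta')
  also have "(\<lambda>h. \<Sum>j<K. \<Sum>k<K. cis (- e j k * \<alpha>) * (of_real h * D (1 + h) (- e j k * \<tau>)))
      = (\<lambda>h. of_real h * G (1 + h))"
    by (simp add: G_def sum_distrib_left mult_ac)
  finally have "((\<lambda>h. Re (of_real h * G (1 + h))) \<longlongrightarrow> Re (of_nat K * (1 + of_nat m))) (at_right 0)"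
    by (rule tendsto_Re)
  moreover have "((\<lambda>h. 4 / \<eta>\<^sup>2 * Re (of_real h * D (1 + h) 0)) \<longlongrightarrow> 4 / \<eta>\<^sup>2 * Re (1 + of_nat m)) (at_right 0)"
    by (intro tendsto_intros zero)
  moreover have "\<forall>\<^sub>F h in at_right 0. Re (of_real h * G (1 + h)) \<le> 4 / \<eta>\<^sup>2 * Re (of_real h * D (1 + h) 0)"
    using eventually_at_right_pos
  proof eventually_elim
    case (elim h)
    have "h * Re (G (1 + h)) \<le> h * (4 / \<eta>\<^sup>2 * Re (D (1 + h) 0))"
      using elim G_le[of "1 + h"] by (intro mult_left_mono) auto
    then show ?case by (simp add: mult_ac)
  qed
  ultimately have "Re (of_nat K * (1 + of_nat m)) \<le> 4 / \<eta>\<^sup>2 * Re (1 + of_nat m)"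
    by (intro tendsto_le[of "at_right (0::real)"]) auto
  then have "real K * (1 + real m) \<le> 4 / \<eta>\<^sup>2 * (1 + real m)" by simp
  then have "real K \<le> 4 / \<eta>\<^sup>2"
    by (rule mult_right_le_imp_le) (simp add: add_pos_nonneg)
  with K show False by simp
qed

end

section \<open>Quadratic residues and reciprocity\<close>

text \<open>Euler's criterion gives the identity modulo p; both sides lie in {-1, 0, 1}, so their
  difference is at most 2 in absolute value and a multiple of p > 2.\<close>

lemma Legendre_mult:
  assumes p: "prime p" "2 < p"
  shows "Legendre (a * b) (int p) = Legendre a (int p) * Legendre b (int p)"
proof -
  have "[Legendre (a * b) p = (a * b) ^ ((p - 1) div 2)] (mod p)"
    using euler_criterion[OF p] .
  moreover have "[Legendre a p * Legendre b p = a ^ ((p - 1) div 2) * b ^ ((p - 1) div 2)] (mod p)"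
    by (intro cong_mult euler_criterion p)
  ultimately have "[Legendre (a * b) p = Legendre a p * Legendre b p] (mod p)"
    by (metis cong_sym cong_trans power_mult_distrib)
  then have dvd: "int p dvd Legendre (a * b) p - Legendre a p * Legendre b p"
    by (simp add: cong_iff_dvd_diff)
  have "\<bar>Legendre (a * b) p - Legendre a p * Legendre b p\<bar> \<le> 2"
    by (simp add: Legendre_def)
  then have "Legendre (a * b) p - Legendre a p * Legendre b p = 0"
    using dvd p(2) zdvd_not_zless[of "\<bar>Legendre (a * b) p - Legendre a p * Legendre b p\<bar>" "int p"]
    by (cases "Legendre (a * b) p - Legendre a p * Legendre b p = 0") auto
  then show ?thesis by simp
qed

lemma Legendre_cong:
  assumes "[a = b] (mod p)"
  shows "Legendre a p = Legendre b p"
proof -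
  have "[a = 0] (mod p) \<longleftrightarrow> [b = 0] (mod p)"
    using assms by (meson cong_sym cong_trans)
  moreover have "QuadRes p a \<longleftrightarrow> QuadRes p b"
    unfolding QuadRes_def using assms by (meson cong_sym cong_trans)
  ultimately show ?thesis by (simp add: Legendre_def)
qed

lemma Legendre_1: "2 < p \<Longrightarrow> Legendre 1 (int p) = 1"
  by (auto simp: Legendre_def QuadRes_def cong_def intro: exI[of _ 1])

text \<open>Gauss's lemma: for p = 2 h + 1 the doubles 2 x with 1 <= x <= h are already reduced
  modulo p, and those above h come from x in (h div 2, h]. The parity of their number depends on h
  modulo 4, that is, on p modulo 8.\<close>

lemma Legendre_2:
  fixes p :: nat
  assumes p: "prime p" "2 < p"
  shows "Legendre 2 (int p) = (if p mod 8 \<in> {1, 7} then 1 else - 1)"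
proof -
  have odd: "odd p" using p prime_odd_nat by blast
  define h where "h = (int p - 1) div 2"
  have ph: "int p = 2 * h + 1"
    using odd unfolding h_def by presburger
  interpret GAUSS p 2
  proof
    show "[2 \<noteq> 0] (mod int p)"
      using p by (auto simp: cong_0_iff dest: zdvd_imp_le)
  qed (use p in auto)
  have "C = (\<lambda>x. 2 * x) ` {0<..h}"
    unfolding C_def B_def A_def h_def[symmetric] image_image
    by (intro image_cong) (auto simp: ph)
  then have "E = (\<lambda>x. 2 * x) ` {h div 2<..h}"
    unfolding E_def h_def[symmetric] by auto
  then have "card E = nat (h - h div 2)"
    by (simp add: card_image inj_on_def)
  then have 1: "Legendre 2 p = (- 1) ^ nat (h - h div 2)"
    using gauss_lemma by simp
  have "h \<ge> 0" using ph p by simp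
  then have "even (nat (h - h div 2)) \<longleftrightarrow> even (h - h div 2)"
    by (subst even_nat_iff) auto
  also have "\<dots> \<longleftrightarrow> h mod 4 = 0 \<or> h mod 4 = 3"
    by presburger
  also have "\<dots> \<longleftrightarrow> p mod 8 = 1 \<or> p mod 8 = 7"
  proof -
    have "int p = (2 * (h mod 4) + 1) + 8 * (h div 4)"
      using ph mult_div_mod_eq[of 4 h] by linarith
    then have "int p mod 8 = (2 * (h mod 4) + 1) mod 8"
      by (simp only: mod_mult_self2)
    also have "\<dots> = 2 * (h mod 4) + 1"
      using pos_mod_bound[of 4 h] pos_mod_sign[of 4 h] by (intro mod_pos_pos_trivial) linarith+
    finally have "int (p mod 8) = 2 * (h mod 4) + 1" by (simp add: zmod_int)
    moreover have "h mod 4 = 0 \<or> h mod 4 = 1 \<or> h mod 4 = 2 \<or> h mod 4 = 3"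
      by presburger
    ultimately show ?thesis by (elim disjE) simp_all
  qed
  finally show ?thesis
    unfolding 1 by auto
qed

text \<open>Squaring modulo q identifies 1 and q - 1. Being noninjective on a finite set, it misses
  some value.\<close>

lemma exists_nonresidue:
  fixes q :: nat
  assumes q: "prime q" "2 < q"
  obtains a :: nat where "Legendre (int a) (int q) = - 1"
proof -
  let ?S = "{0..<int q}"
  define f where "f = (\<lambda>x :: int. x\<^sup>2 mod int q)"
  have "f 1 = f (int q - 1)"
  proof -
    have "(int q - 1)\<^sup>2 = 1 + int q * (int q - 2)" by (simp add: power2_eq_square algebra_simps)
    then show ?thesis unfolding f_def by (simp only: mod_mult_self2) simp
  qed
  then have "\<not> inj_on f ?S"
    using q by (intro notI) (auto dest!: inj_onD[where x = 1 and y = "int q - 1"])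
  moreover have "f ` ?S \<subseteq> ?S" using q by (auto simp: f_def)
  ultimately have "f ` ?S \<noteq> ?S"
    using finite_surj_inj[of ?S f] by auto
  then obtain y where y: "y \<in> ?S" "y \<notin> f ` ?S"
    using \<open>f ` ?S \<subseteq> ?S\<close> by blast
  have "\<not> QuadRes q y"
  proof
    assume "QuadRes q y"
    then obtain x where "x\<^sup>2 mod int q = y mod int q" by (auto simp: QuadRes_def cong_def)
    then have "f (x mod int q) = y" using y(1) by (simp add: f_def power_mod)
    then show False using y(2) q by auto
  qed
  moreover have "\<not> [y = 0] (mod q)"
  proof
    assume "[y = 0] (mod q)"
    then have "y = 0" using y(1) by (simp add: cong_def)
    then have "y = f 0" by (simp add: f_def)
    then show False using y(2) q by auto
  qed
  ultimately have "Legendre (int (nat y)) q = - 1"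
    using y(1) by (simp add: Legendre_def)
  then show ?thesis by (rule that)
qed

text \<open>For odd \<open>n\<close> this is the Kronecker symbol at the prime \<open>q\<close> of the numerator, written by
  quadratic reciprocity as a function of \<open>n\<close> modulo \<open>8 q\<close>.\<close>

definition reciprocal_symbol :: "nat \<Rightarrow> nat \<Rightarrow> int"
  where "reciprocal_symbol q n =
    (if even n then 0
     else if q = 2 then (if n mod 8 \<in> {1, 7} then 1 else - 1)
     else Legendre (int n) (int q) * (if q mod 4 = 3 \<and> n mod 4 = 3 then - 1 else 1))"

lemma reciprocal_symbol_range: "reciprocal_symbol q n \<in> {- 1, 0, 1}"
  by (auto simp: reciprocal_symbol_def Legendre_def)

lemma reciprocal_symbol_mult:
  assumes q: "prime q"
  shows "reciprocal_symbol q (m * n) = reciprocal_symbol q m * reciprocal_symbol q n"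
proof (cases "even m \<or> even n")
  case True
  then show ?thesis by (auto simp: reciprocal_symbol_def)
next
  case False
  have 4: "k mod 4 = 1 \<or> k mod 4 = 3" if "odd k" for k :: nat
    using that by presburger
  have 8: "k mod 8 = 1 \<or> k mod 8 = 3 \<or> k mod 8 = 5 \<or> k mod 8 = 7" if "odd k" for k :: nat
    using that by presburger
  show ?thesis
  proof (cases "q = 2")
    case True
    have "(m * n) mod 8 = (m mod 8) * (n mod 8) mod 8" by (simp add: mod_mult_eq)
    then show ?thesis
      using 8[of m] 8[of n] False True by (auto simp: reciprocal_symbol_def)
  next
    case False2: False
    then have q2: "q > 2" using prime_ge_2_nat[OF q] by simp
    have "(m * n) mod 4 = (m mod 4) * (n mod 4) mod 4" by (simp add: mod_mult_eq)
    then show ?thesis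
      using 4[of m] 4[of n] False False2
      by (auto simp: reciprocal_symbol_def Legendre_mult[OF q q2])
  qed
qed

lemma reciprocal_symbol_cong:
  assumes "[m = n] (mod 8 * q)"
  shows "reciprocal_symbol q m = reciprocal_symbol q n"
proof -
  have 8: "m mod 8 = n mod 8"
    using assms cong_modulus_mult_nat[of m n 8 q] by (simp add: cong_def)
  then have "m mod 4 = n mod 4" "m mod 2 = n mod 2"
    using mod_mod_cancel[of 4 8 m] mod_mod_cancel[of 4 8 n]
      mod_mod_cancel[of 2 8 m] mod_mod_cancel[of 2 8 n] by simp_all
  then have "even m = even n" "m mod 4 = n mod 4"
    by (simp_all add: even_iff_mod_2_eq_zero)
  moreover have "[int m = int n] (mod int q)"
    using assms cong_modulus_mult_nat[of m n q 8] by (simp add: cong_int_iff mult.commute)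
  then have "Legendre (int m) (int q) = Legendre (int n) (int q)"
    by (rule Legendre_cong)
  ultimately show ?thesis using 8 by (simp add: reciprocal_symbol_def)
qed

lemma reciprocal_symbol_1: "prime q \<Longrightarrow> reciprocal_symbol q (Suc 0) = 1"
  using Legendre_1[of q] prime_ge_2_nat[of q] by (cases "q = 2") (auto simp: reciprocal_symbol_def)

text \<open>This links the two views of the symbol: periodic in \<open>p\<close> by definition, and
  by reciprocity (its second supplement for q = 2) the residue symbol of \<open>q\<close> modulo
  \<open>p\<close>.\<close>

lemma reciprocal_symbol_prime:
  assumes q: "prime q" and p: "prime p" "2 < p" "p \<noteq> q"
  shows "reciprocal_symbol q p = Legendre (int q) (int p)"
proof -
  have oddp: "odd p" using p prime_odd_nat by blast
  show ?thesis
  proof (cases "q = 2")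
    case True
    then show ?thesis using Legendre_2[OF p(1,2)] oddp by (simp add: reciprocal_symbol_def)
  next
    case False
    then have q2: "q > 2" using prime_ge_2_nat[OF q] by simp
    then have oddq: "odd q" using q prime_odd_nat by blast
    have rec: "Legendre p q * Legendre q p = (- 1) ^ ((p - 1) div 2 * ((q - 1) div 2))"
      using Quadratic_Reciprocity[OF p(1,2) q q2 p(3)] .
    have half: "even ((n - 1) div 2) \<longleftrightarrow> n mod 4 \<noteq> 3" if "odd n" for n :: nat
      using that by presburger
    have "even ((p - 1) div 2 * ((q - 1) div 2)) \<longleftrightarrow> \<not> (q mod 4 = 3 \<and> p mod 4 = 3)"
      using half[OF oddp] half[OF oddq] by auto
    with rec have "Legendre p q * Legendre q p = (if q mod 4 = 3 \<and> p mod 4 = 3 then - 1 else 1)"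
      by (simp add: minus_one_power_iff)
    moreover have "Legendre q p \<in> {- 1, 0, 1}" by (simp add: Legendre_def)
    ultimately show ?thesis
      using False oddp by (auto simp: reciprocal_symbol_def split: if_splits)
  qed
qed

lemma reciprocal_symbol_eq_0:
  assumes "prime q" "reciprocal_symbol q n = 0"
  shows "even n \<or> q dvd n"
  using assms by (auto simp: reciprocal_symbol_def Legendre_def cong_0_iff split: if_splits)

section \<open>The quadratic character\<close>

text \<open>For \<open>Q\<close> the primes dividing d, this is at odd n the quadratic character
  attached to the square root of d. At even n it is 0 whatever d is, so 2 always counts among the
  finitely many exceptional primes.\<close>

definition reciprocal_character :: "nat set \<Rightarrow> nat \<Rightarrow> int"
  where "reciprocal_character Q n = (\<Prod>q\<in>Q. reciprocal_symbol q n)"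

lemma reciprocal_symbol_coprime:
  assumes "prime q" "reciprocal_symbol q n \<noteq> 0"
  shows "coprime n (8 * q)"
proof -
  have odd: "odd n" using assms by (auto simp: reciprocal_symbol_def)
  have "\<not> q dvd n"
  proof
    assume q: "q dvd n"
    then have "q \<noteq> 2" using odd by auto
    then show False
      using assms(2) q by (auto simp: reciprocal_symbol_def Legendre_def cong_0_iff split: if_splits)
  qed
  then have "coprime n q"
    using assms(1) by (metis coprime_commute prime_imp_coprime)
  moreover have "coprime n (2 ^ 3)"
    using odd by (subst coprime_power_right_iff) (simp add: coprime_commute)
  ultimately show ?thesis by simp
qed

section \<open>Sums of periodic functions\<close>

text \<open>Complete periods cancel, leaving fewer than \<open>N\<close> terms of absolute value at
  most 1.\<close>

lemma periodic_partial_sums: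
  fixes f :: "nat \<Rightarrow> int"
  assumes per: "\<And>n. f (n + N) = f n" and sum0: "(\<Sum>n<N. f n) = 0" and N: "N > 0"
    and f: "\<And>n. \<bar>f n\<bar> \<le> 1"
  shows "\<bar>\<Sum>n<M. f n\<bar> \<le> int N"
proof -
  have shift: "(\<Sum>n<M + N. f n) = (\<Sum>n<M. f n)" for M
    by (induction M) (simp_all add: sum0 per)
  show ?thesis
  proof (induction M rule: less_induct)
    case (less M)
    show ?case
    proof (cases "M < N")
      case True
      have "\<bar>\<Sum>n<M. f n\<bar> \<le> (\<Sum>n<M. \<bar>f n\<bar>)" by (rule sum_abs)
      also have "\<dots> \<le> (\<Sum>n<M. 1)" by (intro sum_mono f)
      finally show ?thesis using True by simp
    next
      case False
      then show ?thesis using less[of "M - N"] shift[of "M - N"] N by simp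
    qed
  qed
qed

text \<open>Multiplication by \<open>c\<close> permutes the residues modulo \<open>N\<close> and
  changes the sign of the sum.\<close>

lemma periodic_sum_eq_0:
  fixes f :: "nat \<Rightarrow> int"
  assumes mult: "\<And>m n. f (m * n) = f m * f n" and per: "\<And>n. f (n mod N) = f n"
    and c: "f c = - 1" "coprime c N"
  shows "(\<Sum>n<N. f n) = 0"
proof -
  have inj: "inj_on (\<lambda>n. c * n mod N) {..<N}"
  proof (rule inj_onI)
    fix x y assume xy: "x \<in> {..<N}" "y \<in> {..<N}" "c * x mod N = c * y mod N"
    then have "[c * x = c * y] (mod N)" by (simp add: cong_def)
    then have "[x = y] (mod N)" using c(2) cong_mult_lcancel_nat by blast
    then show "x = y" using xy by (simp add: cong_def)
  qed
  have "(\<lambda>n. c * n mod N) ` {..<N} = {..<N}"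
    by (rule endo_inj_surj[OF _ _ inj]) auto
  then have "(\<Sum>n<N. f n) = (\<Sum>n<N. f (c * n mod N))"
    using sum.reindex[OF inj, of f] by simp
  also have "\<dots> = - (\<Sum>n<N. f n)"
    by (simp add: per mult c sum_negf)
  finally show ?thesis by simp
qed

context
  fixes Q :: "nat set"
  assumes Q: "finite Q" "Q \<noteq> {}" "\<And>q. q \<in> Q \<Longrightarrow> prime q"
begin

lemma reciprocal_character_range: "reciprocal_character Q n \<in> {- 1, 0, 1}"
  unfolding reciprocal_character_def using Q(1)
proof (induction Q rule: finite_induct)
  case (insert q F)
  then show ?case using reciprocal_symbol_range[of q n] by auto
qed simp

lemma reciprocal_character_nonzero:
  "reciprocal_character Q n \<noteq> 0 \<Longrightarrow> q \<in> Q \<Longrightarrow> reciprocal_symbol q n \<noteq> 0"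
  using Q(1) by (auto simp: reciprocal_character_def)

lemma reciprocal_character_cong:
  assumes "[m = n] (mod 8 * \<Prod>Q)"
  shows "reciprocal_character Q m = reciprocal_character Q n"
  unfolding reciprocal_character_def
proof (intro prod.cong refl reciprocal_symbol_cong)
  fix q assume "q \<in> Q"
  then have "8 * q dvd 8 * \<Prod>Q"
    by (rule mult_dvd_mono[OF dvd_refl dvd_prodI[OF Q(1)]])
  then show "[m = n] (mod 8 * q)" by (rule cong_dvd_modulus_nat[OF assms])
qed

text \<open>This is nonprincipality. Unless \<open>Q = {2}\<close>, choose an odd prime of
  \<open>Q\<close>, take a nonresidue there, and use the Chinese remainder theorem to make all other
  factors equal to 1.\<close>

lemma exists_reciprocal_character_minus_1:
  obtains c where "reciprocal_character Q c = - 1"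
proof (cases "Q = {2}")
  case True
  then show ?thesis using that[of 3] by (simp add: reciprocal_character_def reciprocal_symbol_def)
next
  case False
  then obtain q0 where q0: "q0 \<in> Q" "q0 \<noteq> 2" using Q(2) by blast
  then have q0p: "prime q0" "2 < q0" using Q(3)[of q0] prime_ge_2_nat[of q0] by auto
  then obtain a :: nat where a: "Legendre (int a) (int q0) = - 1"
    using exists_nonresidue by blast
  \<comment> \<open>The factor 8 forces c = 1 modulo 8, so that the reciprocity sign at
    \<open>q0\<close> is trivial as well.\<close>
  define M where "M = 8 * \<Prod>(Q - {q0})"
  have "coprime q0 (\<Prod>(Q - {q0}))"
    using Q q0 by (intro prod_coprime_right) (auto intro: primes_coprime)
  moreover have "coprime q0 (2 ^ 3)"
    using q0p prime_odd_nat by (subst coprime_power_right_iff) auto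
  ultimately have "coprime q0 M" by (simp add: M_def)
  then obtain c where c: "[c = a] (mod q0)" "[c = 1] (mod M)"
    using binary_chinese_remainder_nat by blast
  have "[c = 1] (mod 8)"
    using c(2) unfolding M_def by (rule cong_modulus_mult_nat)
  then have c8: "c mod 8 = 1" by (simp add: cong_def)
  then have "odd c" "c mod 4 = 1" by presburger+
  moreover have "Legendre (int c) q0 = - 1"
    using Legendre_cong[of "int c" "int a" "int q0"] c(1) a by (simp add: cong_int_iff)
  ultimately have "reciprocal_symbol q0 c = - 1"
    using q0 by (simp add: reciprocal_symbol_def)
  moreover have "reciprocal_symbol q c = 1" if "q \<in> Q - {q0}" for q
  proof -
    have "8 * q dvd M"
      unfolding M_def by (rule mult_dvd_mono[OF dvd_refl dvd_prodI[OF finite_Diff[OF Q(1)] that]])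
    then have "[c = Suc 0] (mod 8 * q)" using cong_dvd_modulus_nat[OF c(2)] by simp
    then have "reciprocal_symbol q c = reciprocal_symbol q (Suc 0)" by (rule reciprocal_symbol_cong)
    then show ?thesis using reciprocal_symbol_1 Q(3) that by simp
  qed
  ultimately have "reciprocal_character Q c = - 1"
    unfolding reciprocal_character_def using Q(1) q0(1) by (simp add: prod.remove[of Q q0])
  then show ?thesis by (rule that)
qed

lemma real_character_reciprocal: "real_character (reciprocal_character Q) (real (8 * \<Prod>Q))"
proof
  let ?c = "reciprocal_character Q"
  let ?N = "8 * \<Prod>Q"
  show mult: "?c (m * n) = ?c m * ?c n" for m n
    using Q(3) by (simp add: reciprocal_character_def reciprocal_symbol_mult prod.distrib)
  show "?c 1 = 1"
    using Q(3) by (simp add: reciprocal_character_def reciprocal_symbol_1)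
  show zero: "?c 0 = 0"
    using Q(1,2) by (auto simp: reciprocal_character_def reciprocal_symbol_def)
  show range: "?c n \<in> {- 1, 0, 1}" for n
    by (rule reciprocal_character_range)
  have N: "?N > 0" using Q by (auto intro!: prod_pos simp: prime_gt_0_nat)
  obtain c where c: "?c c = - 1" by (rule exists_reciprocal_character_minus_1)
  have "\<forall>q\<in>Q. coprime c (8 * q)"
  proof
    fix q assume q: "q \<in> Q"
    show "coprime c (8 * q)"
      by (rule reciprocal_symbol_coprime[OF Q(3)[OF q] reciprocal_character_nonzero[OF _ q]])
        (simp add: c)
  qed
  then have "coprime c ?N"
    using Q(2) by (auto intro!: prod_coprime_right)
  then have "(\<Sum>n<?N. ?c n) = 0"
    by (intro periodic_sum_eq_0[OF mult _ c] reciprocal_character_cong) (simp add: cong_def)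
  moreover have "\<bar>?c n\<bar> \<le> 1" for n using range[of n] by auto
  ultimately have "\<bar>\<Sum>n<Suc M. ?c n\<bar> \<le> int ?N" for M
    by (intro periodic_partial_sums N reciprocal_character_cong) (simp_all add: cong_def)
  moreover have "(\<Sum>n<Suc M. ?c n) = (\<Sum>k=1..M. ?c k)" for M
    using zero by (intro sum.mono_neutral_cong_right) (auto simp: Suc_le_eq)
  ultimately show "\<bar>real_of_int (\<Sum>k=1..M. ?c k)\<bar> \<le> real ?N" for M
    by (metis of_int_abs of_int_le_iff of_int_of_nat_eq)
  have "p \<in> insert 2 Q" if p: "prime p" "?c p = 0" for p
  proof -
    obtain q where "q \<in> Q" "reciprocal_symbol q p = 0"
      using p(2) Q(1) by (auto simp: reciprocal_character_def)
    then have "even p \<or> q dvd p" "prime q" using reciprocal_symbol_eq_0 Q(3) by blast+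
    then show ?thesis
      using primes_dvd_imp_eq[OF two_is_prime_nat p(1)] primes_dvd_imp_eq[OF _ p(1), of q] \<open>q \<in> Q\<close>
      by auto
  qed
  then show "finite {p. prime p \<and> ?c p = 0}"
    using finite_subset[of "{p. prime p \<and> ?c p = 0}" "insert 2 Q"] Q(1) by blast
qed

lemma reciprocal_character_prime:
  assumes p: "prime p" and minus: "reciprocal_character Q p = - 1"
  shows "2 < p" and "Legendre (int (\<Prod>Q)) (int p) = - 1"
proof -
  have nz: "reciprocal_symbol q p \<noteq> 0" if "q \<in> Q" for q
    using reciprocal_character_nonzero[of p q] minus that by simp
  obtain q0 where q0: "q0 \<in> Q" using Q(2) by blast
  have "odd p" using nz[OF q0] by (auto simp: reciprocal_symbol_def)
  then show p2: "2 < p" using prime_ge_2_nat[OF p] by (cases "p = 2") auto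
  have sym: "reciprocal_symbol q p = Legendre (int q) (int p)" if q: "q \<in> Q" for q
  proof (rule reciprocal_symbol_prime[OF Q(3)[OF q] p p2])
    show "p \<noteq> q"
    proof
      assume "p = q"
      then have "coprime p (8 * p)" using reciprocal_symbol_coprime[OF _ nz[OF q]] p by simp
      then show False using p2 by simp
    qed
  qed
  have "Legendre (int (\<Prod>F)) (int p) = (\<Prod>q\<in>F. Legendre (int q) (int p))" if "finite F" for F :: "nat set"
    using that
    by (induction F rule: finite_induct) (simp_all add: Legendre_1[OF p2] Legendre_mult[OF p p2])
  from this[OF Q(1)] show "Legendre (int (\<Prod>Q)) (int p) = - 1"
    using minus sym by (simp add: reciprocal_character_def)
qed

end

section \<open>Consequences of square-freeness\<close>

lemma squarefree_prod_prime_factors: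
  fixes n :: nat
  assumes "squarefree n"
  shows "\<Prod>(prime_factors n) = n"
proof -
  have "n > 0" using assms by (auto intro: Nat.gr0I)
  then have "n = (\<Prod>p\<in>prime_factors n. p ^ multiplicity p n)"
    by (simp add: prime_factorization_nat)
  also have "\<dots> = \<Prod>(prime_factors n)"
    using assms \<open>n > 0\<close> by (intro prod.cong) (auto simp: squarefree_factorial_semiring' )
  finally show ?thesis ..
qed

lemma sqrt_squarefree_irrational:
  fixes d :: int
  assumes d: "d > 1" "squarefree d"
  shows "sqrt (of_int d) \<notin> \<rat>"
proof
  assume "sqrt (of_int d) \<in> \<rat>"
  then obtain a b :: int where ab: "sqrt (of_int d) = of_int a / of_int b" "b > 0" "coprime a b"
    by (auto elim: Rats_cases')
  have "of_int d = (of_int a / of_int b :: real)\<^sup>2"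
    using d by (simp flip: ab(1))
  then have "of_int (d * b\<^sup>2) = (of_int (a\<^sup>2) :: real)"
    using ab(2) by (simp add: power_divide field_simps)
  then have eq: "d * b\<^sup>2 = a\<^sup>2" by linarith
  then have "b\<^sup>2 dvd a\<^sup>2" by (metis dvd_triv_right)
  then have "is_unit b"
    using ab(3) by (metis coprime_commute coprime_dvd_mult_left_iff coprime_power_left_iff
        coprime_common_divisor dvd_refl pow_divides_pow_iff zero_less_numeral)
  then have "a\<^sup>2 dvd d" using eq ab(2) by simp
  then have "is_unit a" using d(2) by (auto simp: squarefree_def)
  then have "a\<^sup>2 = 1" by (simp add: abs_square_eq_1)
  then show False using eq \<open>is_unit b\<close> ab(2) d(1) by simp
qed

section \<open>Units and prime elements of quadratic rings\<close>

lemma sqrt_coordinates_unique: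
  fixes d u v u' v' :: int
  assumes irr: "sqrt (of_int d) \<notin> \<rat>"
    and eq: "of_int u + of_int v * sqrt (of_int d) = (of_int u' + of_int v' * sqrt (of_int d) :: real)"
  shows "u = u' \<and> v = v'"
proof -
  have "v = v'"
  proof (rule ccontr)
    assume "v \<noteq> v'"
    then have "sqrt (of_int d) = of_int (u' - u) / (of_int (v - v') :: real)"
      using eq by (simp add: field_simps)
    then have "sqrt (of_int d) \<in> \<rat>" by (metis Rats_divide Rats_of_int)
    then show False using irr by simp
  qed
  then show ?thesis using eq by simp
qed

text \<open>Infinitely many Dirichlet approximations h/k give elements \<open>h + k * sqrt d\<close>
  of bounded norm. Two applications of the pigeonhole principle yield two of them with the same norm
  m and coordinates congruent modulo m; their quotient has integral coordinates and norm 1.\<close>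

lemma exists_pell_solution:
  fixes d :: int
  assumes d: "d > 0" and irr: "sqrt (of_int d) \<notin> \<rat>"
  shows "\<exists>x y :: int. x\<^sup>2 - d * y\<^sup>2 = 1 \<and> y \<noteq> 0"
proof -
  define r where "r = sqrt (real_of_int d)"
  have r: "r > 0" "r * r = of_int d" using d by (simp_all add: r_def)
  define A where "A = approx_set r"
  have inf: "infinite A"
    using irr rational_iff_finite_approx_set[of r] by (simp add: A_def r_def)
  define N where "N = (\<lambda>(h, k). h\<^sup>2 - d * k\<^sup>2 :: int)"
  \<comment> \<open>The norm factors as \<open>e * (e + 2 k r)\<close> with
    \<open>|e| < 1 / k\<close>, which is at most \<open>1 + 2 r\<close> in absolute value.\<close>
  define C where "C = \<lceil>2 * r + 1\<rceil>"
  have "N ` A \<subseteq> {- C..C}"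
  proof (rule image_subsetI)
    fix x assume "x \<in> A"
    moreover obtain h k :: int where x: "x = (h, k)" by fastforce
    ultimately have k: "k > 0" and less: "\<bar>r - of_int h / of_int k\<bar> < 1 / (of_int k)\<^sup>2"
      by (simp_all add: A_def approx_set_def)
    have k1: "real_of_int k \<ge> 1" using k by simp
    define e where "e = of_int h - of_int k * r"
    have "e = - (of_int k * (r - of_int h / of_int k))"
      using k by (simp add: e_def right_diff_distrib)
    then have "\<bar>e\<bar> = real_of_int k * \<bar>r - of_int h / of_int k\<bar>"
      using k by (simp only: abs_minus_cancel abs_mult)
    also have "\<dots> < real_of_int k * (1 / (of_int k)\<^sup>2)"
      using k less by (intro mult_strict_left_mono) auto
    finally have e: "\<bar>e\<bar> < 1 / real_of_int k" using k by (simp add: power2_eq_square)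
    have "real_of_int (N x) = e * (e + 2 * of_int k * r)"
      using r(2) by (simp add: N_def x e_def power2_eq_square algebra_simps)
    then have "\<bar>real_of_int (N x)\<bar> = \<bar>e\<bar> * \<bar>e + 2 * of_int k * r\<bar>" by (simp add: abs_mult)
    also have "\<dots> \<le> 1 / real_of_int k * (1 / real_of_int k + 2 * of_int k * r)"
      using e k r(1) by (intro mult_mono) (auto intro!: order_trans[OF abs_triangle_ineq] simp: abs_mult)
    also have "\<dots> = 1 / real_of_int k * (1 / real_of_int k) + 2 * r"
      using k by (simp add: field_simps)
    also have "\<dots> \<le> 1 * 1 + 2 * r"
      using k1 r(1) by (intro add_mono mult_mono) auto
    finally have "\<bar>real_of_int (N x)\<bar> \<le> of_int C" unfolding C_def by linarith
    then show "N x \<in> {- C..C}" by (simp add: abs_le_iff)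
  qed
  then have "finite (N ` A)" by (rule finite_subset) simp
  from pigeonhole_infinite[OF inf this] obtain x0
    where x0: "x0 \<in> A" "infinite {x \<in> A. N x = N x0}" by blast
  define m where "m = N x0"
  define A' where "A' = {x \<in> A. N x = m}"
  define R where "R = (\<lambda>(h, k). (h mod m, k mod m))"
  have m: "m \<noteq> 0"
  proof
    assume "m = 0"
    then obtain h k :: int where hk: "h\<^sup>2 = d * k\<^sup>2" "k > 0"
      using x0(1) unfolding m_def N_def A_def approx_set_def by auto
    have "(of_int h)\<^sup>2 = (of_int k * r)\<^sup>2"
      using hk(1) r(2) by (metis (no_types) mult.commute of_int_mult of_int_power power2_eq_square power_mult_distrib)
    then have "\<bar>of_int h\<bar> = of_int k * r"
      using hk(2) r(1) by (metis abs_of_pos abs_mult of_int_0_less_iff power2_eq_iff abs_eq_iff)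
    then have "r = of_int \<bar>h\<bar> / of_int k" using hk(2) by (simp add: field_simps)
    then show False using irr unfolding r_def by (metis Rats_divide Rats_of_int)
  qed
  have "R ` A' \<subseteq> {- \<bar>m\<bar>..\<bar>m\<bar>} \<times> {- \<bar>m\<bar>..\<bar>m\<bar>}"
  proof -
    have "\<bar>h mod m\<bar> \<le> \<bar>m\<bar>" for h
      using abs_mod_less[OF m, of h] by simp
    then show ?thesis by (auto simp: R_def abs_le_iff) (metis minus_le_iff)+
  qed
  then have "finite (R ` A')" by (rule finite_subset) simp
  moreover have "infinite A'" using x0(2) by (simp add: A'_def m_def)
  ultimately have "\<not> inj_on R A'" using finite_imageD by blast
  then obtain x y where xy: "x \<in> A'" "y \<in> A'" "R x = R y" "x \<noteq> y" by (auto simp: inj_on_def)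
  obtain h1 k1 h2 k2 where x: "x = (h1, k1)" and y: "y = (h2, k2)" by fastforce
  have pos: "k1 > 0" "k2 > 0" "coprime h1 k1" "coprime h2 k2"
    and norm: "h1\<^sup>2 - d * k1\<^sup>2 = m" "h2\<^sup>2 - d * k2\<^sup>2 = m"
    using xy(1,2) by (auto simp: A'_def A_def approx_set_def N_def x y)
  have cong: "[h1 = h2] (mod m)" "[k1 = k2] (mod m)"
    using xy(3) by (simp_all add: R_def x y cong_def)
  \<comment> \<open>Up to sign, this and \<open>h1 * k2 - k1 * h2\<close> are the coordinates of one
    element times the conjugate of the other. Modulo m they reduce to the norm and to 0, so division
    by m is possible.\<close>
  have "[h1 * h2 - d * k1 * k2 = h2 * h2 - d * k2 * k2] (mod m)"
    by (intro cong_diff cong_mult cong cong_refl)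
  also have "h2 * h2 - d * k2 * k2 = m" using norm(2) by (simp add: power2_eq_square)
  finally have "m dvd h1 * h2 - d * k1 * k2"
    by (simp add: cong_def mod_eq_0_iff_dvd)
  then obtain a where a: "h1 * h2 - d * k1 * k2 = m * a" by blast
  have "[h1 * k2 - k1 * h2 = h2 * k2 - k2 * h2] (mod m)"
    by (intro cong_diff cong_mult cong cong_refl)
  then have "m dvd h1 * k2 - k1 * h2"
    by (simp add: cong_0_iff mult.commute)
  then obtain b where b: "h1 * k2 - k1 * h2 = m * b" by blast
  have "(h1 * h2 - d * k1 * k2)\<^sup>2 - d * (h1 * k2 - k1 * h2)\<^sup>2
      = (h1\<^sup>2 - d * k1\<^sup>2) * (h2\<^sup>2 - d * k2\<^sup>2)"
    by (simp add: power2_eq_square algebra_simps)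
  then have "m * m * (a\<^sup>2 - d * b\<^sup>2) = m * m * 1"
    unfolding a b norm by (simp add: power2_eq_square algebra_simps)
  then have "a\<^sup>2 - d * b\<^sup>2 = 1" using m by simp
  \<comment> \<open>Otherwise the two fractions agree, and in lowest terms this makes the two
    approximations equal.\<close>
  moreover have "b \<noteq> 0"
  proof
    assume "b = 0"
    then have eq: "h1 * k2 = k1 * h2" using b by simp
    have "k1 dvd k2" using eq pos(3) by (metis coprime_commute coprime_dvd_mult_right_iff dvd_triv_left)
    moreover have "k2 dvd k1" using eq pos(4) by (metis coprime_commute coprime_dvd_mult_left_iff dvd_triv_right)
    ultimately have "k1 = k2" using pos(1,2) by (simp add: zdvd_antisym_nonneg)
    then show False using eq pos(2) xy(4) by (simp add: x y)
  qed
  ultimately show ?thesis by blast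
qed

lemma sqrt_in_quad_integers: "sqrt (of_int d) \<in> quad_integers d"
proof (cases "d mod 4 = 1")
  case True
  then have "sqrt (of_int d) = of_int (- 1) + of_int 2 * quad_gen d"
    by (simp add: quad_gen_def field_simps)
  then show ?thesis by (metis quad_integersI)
next
  case False
  then have "sqrt (of_int d) = of_int 0 + of_int 1 * quad_gen d"
    by (simp add: quad_gen_def)
  then show ?thesis by (metis quad_integersI)
qed

text \<open>Absolute values put the Pell solution in the first quadrant, where the element exceeds
  1; its inverse is its conjugate.\<close>

lemma exists_quad_unit:
  fixes d :: int
  assumes d: "d > 1" "squarefree d"
  obtains e e' where "e \<in> quad_integers d" "e' \<in> quad_integers d" "e * e' = 1" "e > 1"
proof -
  obtain x0 y0 :: int where xy0: "x0\<^sup>2 - d * y0\<^sup>2 = 1" "y0 \<noteq> 0"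
    using exists_pell_solution[OF _ sqrt_squarefree_irrational[OF d]] d(1) by auto
  define x y where "x = \<bar>x0\<bar>" and "y = \<bar>y0\<bar>"
  have xy: "x\<^sup>2 - d * y\<^sup>2 = 1" "x \<ge> 0" "y > 0" using xy0 by (simp_all add: x_def y_def)
  have mem: "of_int x + of_int c * sqrt (of_int d) \<in> quad_integers d" for c
    using d(1) by (intro quad_integers_add quad_integers_mult quad_integers_of_int sqrt_in_quad_integers) auto
  let ?e = "of_int x + of_int y * sqrt (of_int d)"
  let ?e' = "of_int x + of_int (- y) * sqrt (of_int d)"
  show ?thesis
  proof (rule that[of ?e ?e'])
    have "sqrt (of_int d) * sqrt (of_int d) = (of_int d :: real)" using d(1) by simp
    then have "?e * ?e' = of_int (x\<^sup>2 - d * y\<^sup>2)"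
      by (simp add: algebra_simps power2_eq_square)
    then show "?e * ?e' = 1" using xy(1) by simp
    have "1 * 1 < real_of_int y * sqrt (of_int d)"
      using xy(3) d(1) by (intro mult_le_less_imp_less) auto
    then show "?e > 1" using xy(2) by (simp add: add_nonneg_pos)
  qed (rule mem)+
qed

section \<open>Prime elements and inert rational primes\<close>

lemma quad_primes_iff:
  assumes "d \<ge> 0"
  shows "z \<in> quad_primes d \<longleftrightarrow> z \<in> quad_integers d \<and> z \<noteq> 0 \<and> (\<forall>u\<in>quad_integers d. u * z \<noteq> 1)
    \<and> (\<forall>a\<in>quad_integers d. \<forall>b\<in>quad_integers d. (\<exists>c\<in>quad_integers d. a * b = z * c) \<longrightarrow>
        (\<exists>c\<in>quad_integers d. a = z * c) \<or> (\<exists>c\<in>quad_integers d. b = z * c))"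
  by (auto simp: quad_primes_def quad_ring_def ring_prime_def Divisibility.prime_def factor_def
      Units_def mult.commute)

lemma quad_primes_mult_unit:
  assumes d: "d \<ge> 0" and z: "z \<in> quad_primes d"
    and e: "e \<in> quad_integers d" "e' \<in> quad_integers d" "e * e' = 1"
  shows "z * e \<in> quad_primes d"
proof -
  have assoc: "(\<exists>c\<in>quad_integers d. a = z * e * c) \<longleftrightarrow> (\<exists>c\<in>quad_integers d. a = z * c)" for a
  proof
    assume "\<exists>c\<in>quad_integers d. a = z * e * c"
    then show "\<exists>c\<in>quad_integers d. a = z * c"
      using quad_integers_mult[OF d e(1)] by (auto simp: mult.assoc)
  next
    assume "\<exists>c\<in>quad_integers d. a = z * c"
    then obtain c where c: "c \<in> quad_integers d" "a = z * c" by blast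
    then have "a = z * e * (e' * c)"
      using e(3) by (simp add: mult.assoc[symmetric] mult.assoc[of z e e'])
    then show "\<exists>c\<in>quad_integers d. a = z * e * c"
      using quad_integers_mult[OF d e(2) c(1)] by blast
  qed
  have "u * (z * e) \<noteq> 1" if u: "u \<in> quad_integers d" for u
  proof
    assume "u * (z * e) = 1"
    then have "(e * u) * z = 1" by (simp add: mult_ac)
    then show False
      using z quad_integers_mult[OF d e(1) u] by (auto simp: quad_primes_iff[OF d])
  qed
  then show ?thesis
    using z e quad_integers_mult[OF d _ e(1)] unfolding quad_primes_iff[OF d] assoc by auto
qed

text \<open>If p divides x y, it divides the product of the norms of 2 x and 2 y, hence one norm
  \<open>u^2 - d v^2\<close>. As d is a nonresidue, p then divides u and v, and so the element
  itself.\<close>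

lemma inert_prime_in_quad_primes:
  fixes d :: int and p :: nat
  assumes d: "d > 1" "squarefree d" and p: "prime p" "2 < p" and inert: "Legendre d (int p) = - 1"
  shows "real p \<in> quad_primes d"
proof -
  let ?s = "sqrt (of_int d) :: real"
  have d0: "d \<ge> 0" using d by simp
  have ss: "?s * ?s = of_int d" using d by simp
  note unique = sqrt_coordinates_unique[OF sqrt_squarefree_irrational[OF d]]
  have pp: "prime (int p)" using p by simp
  have odd: "odd (int p)" using p prime_odd_nat by auto
  \<comment> \<open>Doubling clears the denominator of the generator when d = 1 modulo 4, so both
    shapes of the ring share the form u + v sqrt d; since p is odd, divisibility by p passes back to
    the coordinates a and b.\<close>
  have coords: "\<exists>a b u v :: int. x = of_int a + of_int b * quad_gen d \<and> 2 * x = of_int u + of_int v * ?s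
      \<and> (int p dvd u \<and> int p dvd v \<longrightarrow> int p dvd a \<and> int p dvd b)"
    if "x \<in> quad_integers d" for x
  proof -
    obtain a b :: int where x: "x = of_int a + of_int b * quad_gen d"
      using \<open>x \<in> quad_integers d\<close> unfolding quad_integers_def by blast
    have cancel: "int p dvd c" if "int p dvd 2 * c" for c
    proof -
      have "coprime (int p) 2" using odd by simp
      then show ?thesis using that by (simp only: coprime_dvd_mult_right_iff)
    qed
    show ?thesis
    proof (cases "d mod 4 = 1")
      case True
      then have 2: "2 * x = of_int (2 * a + b) + of_int b * ?s"
        by (simp add: x quad_gen_def field_simps)
      have "int p dvd a" if "int p dvd 2 * a + b" "int p dvd b"
        by (rule cancel) (use that in \<open>simp only: dvd_add_left_iff\<close>)
      then have 3: "int p dvd 2 * a + b \<and> int p dvd b \<longrightarrow> int p dvd a \<and> int p dvd b"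
        by blast
      show ?thesis by (intro exI conjI) (fact x 2 3)+
    next
      case False
      then have 2: "2 * x = of_int (2 * a) + of_int (2 * b) * ?s"
        by (simp add: x quad_gen_def field_simps)
      have 3: "int p dvd 2 * a \<and> int p dvd 2 * b \<longrightarrow> int p dvd a \<and> int p dvd b"
        using cancel[of a] cancel[of b] by blast
      show ?thesis by (intro exI conjI) (fact x 2 3)+
    qed
  qed
  \<comment> \<open>If p did not divide v, then u divided by v would be a square root of d modulo
    p.\<close>
  have nonresidue: "int p dvd u \<and> int p dvd v" if uv: "int p dvd u\<^sup>2 - d * v\<^sup>2" for u v :: int
  proof (cases "int p dvd v")
    case True
    then have "int p dvd d * v\<^sup>2" by (simp add: power2_eq_square)
    from dvd_add[OF uv this] have "int p dvd u\<^sup>2" by simp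
    from prime_dvd_power[OF pp this] True show ?thesis by simp
  next
    case False
    then have "coprime v (int p)" using prime_imp_coprime[OF pp] by (simp add: coprime_commute)
    then obtain w where w: "[v * w = 1] (mod int p)" using cong_solve_coprime_int by blast
    have "[u\<^sup>2 = d * v\<^sup>2] (mod int p)" using uv by (simp add: cong_iff_dvd_diff)
    then have "[u\<^sup>2 * w\<^sup>2 = d * v\<^sup>2 * w\<^sup>2] (mod int p)" by (rule cong_scalar_right)
    moreover have "[d * (v * w)\<^sup>2 = d * 1\<^sup>2] (mod int p)" by (intro cong_scalar_left cong_pow w)
    ultimately have "[(u * w)\<^sup>2 = d] (mod int p)"
      using cong_trans by (simp add: power_mult_distrib mult.assoc) blast
    then have "QuadRes (int p) d" unfolding QuadRes_def by blast
    then show ?thesis using inert by (simp add: Legendre_def split: if_splits)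
  qed
  have divisible: "\<exists>c\<in>quad_integers d. x = real p * c"
    if x: "x \<in> quad_integers d" "2 * x = of_int u + of_int v * ?s" "int p dvd u\<^sup>2 - d * v\<^sup>2" for x u v
  proof -
    obtain a b u' v' :: int where c: "x = of_int a + of_int b * quad_gen d" "2 * x = of_int u' + of_int v' * ?s"
        "int p dvd u' \<and> int p dvd v' \<longrightarrow> int p dvd a \<and> int p dvd b"
      using coords[OF x(1)] by blast
    have "u' = u \<and> v' = v" using x(2) c(2) by (intro unique) simp
    then obtain a' b' where ab: "a = int p * a'" "b = int p * b'"
      using c(3) nonresidue[OF x(3)] by (auto elim!: dvdE)
    have "x = real p * (of_int a' + of_int b' * quad_gen d)"
      unfolding c(1) ab by (simp add: algebra_simps)
    then show ?thesis using quad_integersI by blast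
  qed
  show ?thesis
    unfolding quad_primes_iff[OF d0]
  proof (intro conjI ballI impI)
    show "real p \<in> quad_integers d" using quad_integers_of_int[of "int p" d] by simp
    show "real p \<noteq> 0" using p by simp
  next
    fix x assume x: "x \<in> quad_integers d"
    show "x * real p \<noteq> 1"
    proof
      assume 1: "x * real p = 1"
      obtain u v :: int where "2 * x = of_int u + of_int v * ?s" using coords[OF x] by blast
      then have "2 * (x * real p) = (of_int u + of_int v * ?s) * real p" by simp
      then have "of_int (u * int p) + of_int (v * int p) * ?s = of_int 2 + of_int 0 * ?s"
        using 1 by (simp add: algebra_simps)
      then have "u * int p = 2" using unique by blast
      then have "int p dvd 2" by (metis dvd_triv_right)
      then show False using p(2) zdvd_imp_le[of "int p" 2] by simp
    qed
  next
    fix x y assume x: "x \<in> quad_integers d" and y: "y \<in> quad_integers d"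
      and "\<exists>c\<in>quad_integers d. x * y = real p * c"
    then obtain z where z: "z \<in> quad_integers d" "x * y = real p * z" by blast
    obtain u v :: int where uv: "2 * x = of_int u + of_int v * ?s" using coords[OF x] by blast
    obtain u' v' :: int where uv': "2 * y = of_int u' + of_int v' * ?s" using coords[OF y] by blast
    obtain r t :: int where rt: "2 * z = of_int r + of_int t * ?s" using coords[OF z(1)] by blast
    have "(2 * x) * (2 * y) = 2 * real p * (2 * z)" using z(2) by simp
    then have "of_int (u * u' + d * v * v') + of_int (u * v' + v * u') * ?s
        = of_int (2 * int p * r) + of_int (2 * int p * t) * ?s"
      unfolding uv uv' rt using ss by (simp add: algebra_simps)
    then have prod: "u * u' + d * v * v' = 2 * int p * r" "u * v' + v * u' = 2 * int p * t"
      using unique by blast+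
    have "(u\<^sup>2 - d * v\<^sup>2) * (u'\<^sup>2 - d * v'\<^sup>2) = (u * u' + d * v * v')\<^sup>2 - d * (u * v' + v * u')\<^sup>2"
      by (simp add: power2_eq_square algebra_simps)
    also have "\<dots> = int p * (4 * int p * (r\<^sup>2 - d * t\<^sup>2))"
      unfolding prod by (simp add: power2_eq_square algebra_simps)
    finally have "int p dvd (u\<^sup>2 - d * v\<^sup>2) * (u'\<^sup>2 - d * v'\<^sup>2)" by simp
    then have "int p dvd u\<^sup>2 - d * v\<^sup>2 \<or> int p dvd u'\<^sup>2 - d * v'\<^sup>2"
      using pp by (simp add: prime_dvd_mult_iff)
    then show "(\<exists>c\<in>quad_integers d. x = real p * c) \<or> (\<exists>c\<in>quad_integers d. y = real p * c)"
      using divisible[OF x uv] divisible[OF y uv'] by blast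
  qed
qed

section \<open>Density of the quotients\<close>

text \<open>The chord from 1 to \<open>cis x\<close> has squared length \<open>2 - 2 cos x\<close>,
  and \<eta> is the chord of angle \<epsilon>. Capping \<epsilon> at \<open>pi\<close> keeps it
  where the cosine is injective.\<close>

lemma norm_cis_minus_1_small_imp:
  assumes "\<delta> > 0"
  obtains \<eta> where "\<eta> > 0"
    and "\<And>x. norm (cis x - 1) < \<eta> \<Longrightarrow> \<exists>k :: int. \<bar>x - 2 * pi * of_int k\<bar> < \<delta>"
proof -
  define \<epsilon> where "\<epsilon> = min \<delta> pi"
  have \<epsilon>: "0 < \<epsilon>" "\<epsilon> \<le> pi" "\<epsilon> \<le> \<delta>" using assms by (auto simp: \<epsilon>_def)
  have cos_less: "cos \<epsilon> < 1" using cos_monotone_0_pi[of 0 \<epsilon>] \<epsilon> by simp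
  show ?thesis
  proof (rule that[of "sqrt (2 - 2 * cos \<epsilon>)"])
    show "sqrt (2 - 2 * cos \<epsilon>) > 0" using cos_less by simp
    fix x :: real assume x: "norm (cis x - 1) < sqrt (2 - 2 * cos \<epsilon>)"
    have "(norm (cis x - 1))\<^sup>2 = (cos x - 1)\<^sup>2 + (sin x)\<^sup>2"
      by (simp add: cmod_power2)
    also have "\<dots> = 2 - 2 * cos x"
      using sin_cos_squared_add[of x] by (simp add: power2_eq_square algebra_simps)
    finally have "(norm (cis x - 1))\<^sup>2 = 2 - 2 * cos x" .
    moreover have "(norm (cis x - 1))\<^sup>2 < (sqrt (2 - 2 * cos \<epsilon>))\<^sup>2"
      using x by (intro power_strict_mono) auto
    ultimately have "cos \<epsilon> < cos x" using cos_less by simp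
    then have "arccos (cos x) < arccos (cos \<epsilon>)"
      by (intro arccos_less_arccos) auto
    also have "\<dots> = \<epsilon>" using \<epsilon> by (intro arccos_cos) auto
    finally have "arccos (cos x) < \<epsilon>" .
    moreover obtain k where "arccos (cos x) = \<bar>x - of_int k * (2 * pi)\<bar>"
      using arccos_cos_eq_abs_2pi by blast
    ultimately show "\<exists>k :: int. \<bar>x - 2 * pi * of_int k\<bar> < \<delta>"
      using \<epsilon>(3) by (intro exI[of _ k]) (simp add: mult.commute)
  qed
qed

lemma (in real_character) log_inert_prime_dense:
  assumes l: "l > 0" and \<delta>: "\<delta> > 0"
  obtains p and k :: int where "prime p" "chi p = -1" "\<bar>ln (real p) - of_int k * l - t\<bar> < \<delta>"
proof -
  \<comment> \<open>At this frequency, \<open>ln p\<close> modulo \<open>l\<close> becomes an angle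
    modulo \<open>2 * pi\<close>.\<close>
  define \<tau> where "\<tau> = 2 * pi / l"
  have \<tau>: "\<tau> > 0" using l by (simp add: \<tau>_def)
  obtain \<eta> where \<eta>: "\<eta> > 0"
      "\<And>x. norm (cis x - 1) < \<eta> \<Longrightarrow> \<exists>k :: int. \<bar>x - 2 * pi * of_int k\<bar> < \<tau> * \<delta>"
    using norm_cis_minus_1_small_imp[of "\<tau> * \<delta>"] \<tau> \<delta> by (metis mult_pos_pos)
  obtain p where p: "prime p" "chi p = -1" "norm (cis (\<tau> * ln (real p) - \<tau> * t) - 1) < \<eta>"
    using inert_phase_dense[of \<tau> \<eta> "\<tau> * t"] \<tau> \<eta>(1) by auto
  obtain k :: int where "\<bar>\<tau> * ln (real p) - \<tau> * t - 2 * pi * of_int k\<bar> < \<tau> * \<delta>"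
    using \<eta>(2)[OF p(3)] by blast
  also have "\<tau> * ln (real p) - \<tau> * t - 2 * pi * of_int k = \<tau> * (ln (real p) - of_int k * l - t)"
    using l by (simp add: \<tau>_def field_simps)
  finally have "\<bar>ln (real p) - of_int k * l - t\<bar> < \<delta>"
    using \<tau> by (simp add: abs_mult)
  with p(1,2) show ?thesis by (rule that)
qed

lemma quad_primes_mult_unit_powi:
  assumes d: "d \<ge> 0" and z: "z \<in> quad_primes d"
    and e: "e \<in> quad_integers d" "e' \<in> quad_integers d" "e * e' = 1"
  shows "z * e powi k \<in> quad_primes d"
proof -
  have e0: "e \<noteq> 0" "e' \<noteq> 0" using e(3) by auto
  have inv: "e' = inverse e" using e(3) by (simp add: inverse_unique)
  have pow: "z * e ^ n \<in> quad_primes d" for n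
    by (induction n) (use z quad_primes_mult_unit[OF d _ e]
      in \<open>auto simp: power_Suc2 mult.assoc[symmetric] simp del: power_Suc\<close>)
  have pow': "z * e' ^ n \<in> quad_primes d" for n
    by (induction n) (use z quad_primes_mult_unit[OF d _ e(2,1)] e(3)
      in \<open>auto simp: power_Suc2 mult.assoc[symmetric] mult.commute[of e' e] simp del: power_Suc\<close>)
  show ?thesis
  proof (cases "k \<ge> 0")
    case True
    then show ?thesis using pow[of "nat k"] by (simp add: power_int_def)
  next
    case False
    then show ?thesis using pow'[of "nat (- k)"] by (simp add: power_int_def inv)
  qed
qed

theorem theorem5p2:
  fixes d :: int
  assumes "d > 1" and "squarefree d"
  shows "closure {p / q | p q. p \<in> quad_primes d \<and> q \<in> quad_primes d} = (UNIV :: real set)"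
proof -
  let ?S = "{p / q | p q. p \<in> quad_primes d \<and> q \<in> quad_primes d}"
  have d0: "d \<ge> 0" using assms by simp
  define Q where "Q = prime_factors (nat d)"
  have sq: "squarefree (nat d)"
  proof (rule squarefreeI)
    fix x assume "x\<^sup>2 dvd nat d"
    then have "int (x\<^sup>2) dvd int (nat d)" by (simp only: int_dvd_int_iff)
    then have "(int x)\<^sup>2 dvd d" using d0 by simp
    then have "int x dvd 1" by (rule squarefreeD[OF assms(2)])
    then show "x dvd 1" by simp
  qed
  have Q: "finite Q" "\<And>q. q \<in> Q \<Longrightarrow> prime q" by (auto simp: Q_def)
  have prodQ: "int (\<Prod>Q) = d"
    using squarefree_prod_prime_factors[OF sq] assms by (simp add: Q_def)
  then have Q0: "Q \<noteq> {}" using assms by auto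
  interpret real_character "reciprocal_character Q" "real (8 * \<Prod>Q)"
    by (rule real_character_reciprocal[OF Q(1) Q0 Q(2)])
  have inert: "real p \<in> quad_primes d" "p > 0" if "prime p" "reciprocal_character Q p = - 1" for p
    using inert_prime_in_quad_primes[OF assms that(1)] reciprocal_character_prime[OF Q(1) Q0 Q(2) that]
    by (auto simp: prodQ simp del: of_nat_prod)
  obtain e e' where e: "e \<in> quad_integers d" "e' \<in> quad_integers d" "e * e' = 1" "e > 1"
    using exists_quad_unit[OF assms] by blast
  have le: "ln e > 0" using e(4) by simp
  \<comment> \<open>Any inert prime serves as the fixed denominator; the density statement also
    supplies its existence.\<close>
  obtain q where q: "prime q" "reciprocal_character Q q = - 1"
    using log_inert_prime_dense[OF le zero_less_one] by blast
  have "x \<in> closure ?S" if x: "x \<noteq> 0" for x :: real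
    unfolding closure_approachable
  proof (intro allI impI)
    fix \<epsilon> :: real assume \<epsilon>: "\<epsilon> > 0"
    have "isCont exp (0 :: real)" by simp
    \<comment> \<open>An error \<delta> in the logarithm is a relative error in the quotient, and
      relative error \<open>\<epsilon> / |x|\<close> at \<open>|x|\<close> is absolute error
      \<epsilon>.\<close>
    then obtain \<delta> where \<delta>: "\<delta> > 0" "\<And>y :: real. \<bar>y\<bar> < \<delta> \<Longrightarrow> \<bar>exp y - 1\<bar> < \<epsilon> / \<bar>x\<bar>"
      using \<epsilon> x unfolding continuous_at_eps_delta dist_real_def
      by (metis diff_zero divide_pos_pos exp_zero zero_less_abs_iff)
    obtain p and k :: int where p: "prime p" "reciprocal_character Q p = - 1"
      and close: "\<bar>ln (real p) - of_int k * ln e - ln (\<bar>x\<bar> * real q)\<bar> < \<delta>"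
      using log_inert_prime_dense[OF le \<delta>(1)] by blast
    define z where "z = real p * e powi (- k)"
    define y where "y = z / real q"
    have z: "z \<in> quad_primes d"
      unfolding z_def using inert(1)[OF p] e d0 by (intro quad_primes_mult_unit_powi)
    have pq: "real p > 0" "real q > 0" using inert(2) p q by auto
    have "exp (ln (real p) - of_int k * ln e - ln (\<bar>x\<bar> * real q))
        = exp (ln (real p)) * exp (- of_int k * ln e) / exp (ln (\<bar>x\<bar> * real q))"
      by (simp add: exp_diff exp_minus exp_add field_simps)
    also have "\<dots> = real p * e powr (- of_int k) / (\<bar>x\<bar> * real q)"
      using pq x e(4) by (simp add: powr_def)
    also have "e powr (- of_int k) = e powi (- k)"
      using e(4) powr_real_of_int'[of e "- k"] by simp
    finally have exp: "exp (ln (real p) - of_int k * ln e - ln (\<bar>x\<bar> * real q)) = y / \<bar>x\<bar>"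
      by (simp add: y_def z_def field_simps)
    have "\<bar>y / \<bar>x\<bar> - 1\<bar> < \<epsilon> / \<bar>x\<bar>"
      using \<delta>(2)[OF close] exp by simp
    then have "\<bar>x\<bar> * \<bar>y / \<bar>x\<bar> - 1\<bar> < \<epsilon>" using x by (simp add: field_simps)
    also have "\<bar>x\<bar> * \<bar>y / \<bar>x\<bar> - 1\<bar> = \<bar>\<bar>x\<bar> * (y / \<bar>x\<bar> - 1)\<bar>"
      by (simp only: abs_mult abs_abs)
    also have "\<bar>x\<bar> * (y / \<bar>x\<bar> - 1) = y - \<bar>x\<bar>"
      using x by (simp add: right_diff_distrib)
    finally have less: "\<bar>y - \<bar>x\<bar>\<bar> < \<epsilon>" .
    \<comment> \<open>The construction approximates \<open>|x|\<close>; multiplying the numerator by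
      the unit -1 reaches negative targets.\<close>
    have "- 1 \<in> quad_integers d" using quad_integers_of_int[of "- 1" d] by simp
    from quad_primes_mult_unit[OF d0 z this this] have "- z \<in> quad_primes d" by simp
    then have "sgn x * z \<in> quad_primes d"
      using z x by (cases "x > 0") simp_all
    moreover have "sgn x * y = (sgn x * z) / real q" by (simp add: y_def)
    ultimately have "sgn x * y \<in> ?S" using inert(1)[OF q] by blast
    moreover have "dist (sgn x * y) x < \<epsilon>"
      using less x by (cases "x > 0") (auto simp: dist_real_def)
    ultimately show "\<exists>y\<in>?S. dist y x < \<epsilon>" by blast
  qed
  then have "UNIV - {0} \<subseteq> closure ?S" by blast
  then have "closure (UNIV - {0 :: real}) \<subseteq> closure ?S"
    by (rule closure_minimal) simp
  moreover have "closure (UNIV - {0 :: real}) = UNIV"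
    by (simp add: closure_complement Compl_eq_Diff_UNIV[symmetric])
  ultimately show ?thesis by blast
qed

end
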